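(* Let $K$ be a field and let $\mathcal P$ be a simple collection of cells of $\mathbb N^2$ such that each connected component of $\mathcal P$ is row convex or column convex. Then $I_{\mathcal P}$ is a prime ideal.
   Context: Order $\mathbb N^2$ by $(i,j)\le(k,l)$ iff $i\le k$ and $j\le l$; for $a\le b$ let $[a,b]=\{c: a\le c\le b\}$. For $a=(i,j)$, $b=(k,l)$ with $i<k$, $j<l$ the interval $[a,b]$ is proper, with anti-diagonal corners $c=(k,j)$, $d=(i,l)$. A cell with lower left corner $a$ is $C=[a,a+(1,1)]$, a unit square with four vertices $V(C)$ and four edges. A cell with lower left corner $(r,s)$ belongs to $[(i,j),(k,l)]$ if $i\le r\le k-1$, $j\le s\le l-1$; it is a border cell of that interval if one of these inequalities is an equality. A collection of cells $\mathcal P$ is a finite set of cells; $V(\mathcal P)=\bigcup_{C\in\mathcal P}V(C)$. Two cells of a collection are connected in it if there is a sequence of cells of the collection from one to the other in which consecutive cells share a common edge; the connected components of $\mathcal P$ are the classes of this relation. $\mathcal P$ is row convex if whenever the cells with lower left corners $(i,j)$ and $(k,j)$, $i\le k$, are in $\mathcal P$, all cells with lower left corner $(r,j)$, $i\le r\le k$, are in $\mathcal P$; column convex is defined analogously for vertical position. Choose (translating $\mathcal P$ if necessary) a proper interval $[a,b]$ such that every element of $V(\mathcal P)$ is a vertex of four distinct cells belonging to $[a,b]$. $\mathcal P$ is simple if every cell $C$ belonging to $[a,b]$ with $C\notin\mathcal P$ can be joined to a border cell $D$ of $[a,b]$ by a sequence $C=C_1,\dots,C_m=D$ of cells belonging to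 $[a,b]$, consecutive ones sharing an edge, with $C_i\notin\mathcal P$ for all $i$ (no holes; $\mathcal P$ itself need not be connected). A proper interval $[a,b]$ is an inner interval of $\mathcal P$ if all cells belonging to it are in $\mathcal P$; then $f_{a,b}=x_ax_b-x_cx_d$ is an inner 2-minor. $S=K[x_a:a\in V(\mathcal P)]$ and $I_{\mathcal P}\subset S$ is the ideal generated by all inner 2-minors of $\mathcal P$. *)

theory Defs
  imports
    "HOL-Library.Poly_Mapping"
    "HOL-Library.Product_Order"
    "HOL-Library.Product_Plus"
    "HOL-Algebra.Ideal"
begin

text \<open>
  The order on \<^typ>\<open>nat \<times> nat\<close> is the componentwise one of Product_Order, so the interval
  \<open>[a, b]\<close> is the library interval \<open>{a..b}\<close>.
  A cell is encoded by its lower left corner; a collection of cells is thus a finite set of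
  points of type \<^typ>\<open>nat \<times> nat\<close>.
\<close>

type_synonym point = "nat \<times> nat"

subsection \<open>Cells and collections of cells\<close>

definition proper_interval :: "point \<Rightarrow> point \<Rightarrow> bool" where
  "proper_interval a b \<longleftrightarrow> fst a < fst b \<and> snd a < snd b"

definition cell_vertices :: "point \<Rightarrow> point set" where
  "cell_vertices C = {C .. C + (1, 1)}"

text \<open>An edge is the set of its two end points.\<close>

definition cell_edges :: "point \<Rightarrow> point set set" where
  "cell_edges C =
     {{C, C + (1, 0)}, {C, C + (0, 1)},
      {C + (1, 0), C + (1, 1)}, {C + (0, 1), C + (1, 1)}}"

definition vertices :: "point set \<Rightarrow> point set" where
  "vertices P = (\<Union>C\<in>P. cell_vertices C)"

definition interval_cells :: "point \<Rightarrow> point \<Rightarrow> point set" where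
  "interval_cells a b =
     {(r, s). fst a \<le> r \<and> r < fst b \<and> snd a \<le> s \<and> s < snd b}"

definition border_cells :: "point \<Rightarrow> point \<Rightarrow> point set" where
  "border_cells a b =
     {(r, s) \<in> interval_cells a b.
        r = fst a \<or> r + 1 = fst b \<or> s = snd a \<or> s + 1 = snd b}"

definition adjacent_cells :: "point set \<Rightarrow> (point \<times> point) set" where
  "adjacent_cells P =
     {(C, D). C \<in> P \<and> D \<in> P \<and> cell_edges C \<inter> cell_edges D \<noteq> {}}"

definition connected_cells :: "point set \<Rightarrow> (point \<times> point) set" where
  "connected_cells P = (adjacent_cells P)\<^sup>* \<inter> P \<times> P"

definition cell_components :: "point set \<Rightarrow> point set set" where
  "cell_components P = P // connected_cells P"

definition row_convex :: "point set \<Rightarrow> bool" where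
  "row_convex P \<longleftrightarrow>
     (\<forall>i k j. i \<le> k \<and> (i, j) \<in> P \<and> (k, j) \<in> P \<longrightarrow> (\<forall>r\<in>{i..k}. (r, j) \<in> P))"

definition column_convex :: "point set \<Rightarrow> bool" where
  "column_convex P \<longleftrightarrow>
     (\<forall>i j l. j \<le> l \<and> (i, j) \<in> P \<and> (i, l) \<in> P \<longrightarrow> (\<forall>s\<in>{j..l}. (i, s) \<in> P))"

definition frame :: "point set \<Rightarrow> point \<Rightarrow> point \<Rightarrow> bool" where
  "frame P a b \<longleftrightarrow> proper_interval a b \<and>
     (\<forall>v\<in>vertices P. card {C \<in> interval_cells a b. v \<in> cell_vertices C} = 4)"

definition simple_in_frame :: "point set \<Rightarrow> point \<Rightarrow> point \<Rightarrow> bool" where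
  "simple_in_frame P a b \<longleftrightarrow>
     (\<forall>C \<in> interval_cells a b - P. \<exists>D \<in> border_cells a b.
        (C, D) \<in> (adjacent_cells (interval_cells a b - P))\<^sup>*)"

text \<open>
  A collection with vertices on a coordinate axis has no frame in the quadrant, hence the
  translation by \<open>t\<close>. The choice of \<open>t\<close>, \<open>a\<close> and \<open>b\<close> does not matter: no cell outside or on the
  border of a frame lies in the collection, and from such a cell one reaches the border of any
  larger frame by going straight outwards.
\<close>

definition simple_collection :: "point set \<Rightarrow> bool" where
  "simple_collection P \<longleftrightarrow>
     (\<exists>t a b. frame ((+) t ` P) a b \<and> simple_in_frame ((+) t ` P) a b)"

definition inner_interval :: "point set \<Rightarrow> point \<Rightarrow> point \<Rightarrow> bool" where
  "inner_interval P a b \<longleftrightarrow> proper_interval a b \<and> interval_cells a b \<subseteq> P"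

subsection \<open>The polynomial ring and the ideal of inner 2-minors\<close>

text \<open>
  Polynomials in variables indexed by all points: finitely supported maps from monomials
  (finitely supported exponent vectors) to coefficients. The ring \<open>K[x\<^sub>a : a \<in> V]\<close> consists of
  those polynomials whose monomials only involve variables indexed by \<open>V\<close>.
\<close>

type_synonym 'k point_poly = "(point \<Rightarrow>\<^sub>0 nat) \<Rightarrow>\<^sub>0 'k"

definition poly_ring :: "point set \<Rightarrow> 'k::field point_poly ring" where
  "poly_ring V =
     \<lparr>carrier = {p. \<forall>m \<in> Poly_Mapping.keys p. Poly_Mapping.keys m \<subseteq> V},
      monoid.mult = (*), one = 1, zero = 0, add = (+)\<rparr>"

definition var :: "point \<Rightarrow> 'k::field point_poly" where
  "var a = Poly_Mapping.single (Poly_Mapping.single a 1) 1"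

definition minor :: "point \<Rightarrow> point \<Rightarrow> 'k::field point_poly" where
  "minor a b = var a * var b - var (fst b, snd a) * var (fst a, snd b)"

definition inner_minors :: "point set \<Rightarrow> 'k::field point_poly set" where
  "inner_minors P = {minor a b | a b. inner_interval P a b}"

definition inner_minor_ideal :: "point set \<Rightarrow> 'k::field point_poly set" where
  "inner_minor_ideal P = Idl\<^bsub>poly_ring (vertices P)\<^esub> (inner_minors P)"

end

theory Submission
  imports Defs "HOL-Library.Multiset" "HOL-Library.Nat_Bijection"
begin

text \<open>
  Call an integer function on the points a potential if on every cell of \<open>P\<close> the sums over the two
  diagonals agree. Sending \<open>x\<^sub>p\<close> to the product of variables \<open>y\<^sub>c\<close>, where \<open>c\<close> runs through the
  points \<open>\<ge> p\<close> of a large box that are not cells of \<open>P\<close>, identifies two monomials exactly if all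
  potentials agree on them, and the image is an integral domain. So \<open>I\<^sub>P\<close> is prime once any two
  monomials on which all potentials agree are related by a chain of inner minors.

  If \<open>P\<close> is row convex, take the lowest row occupied by a monomial, and in it the column whose
  vertical segment ends first among those available: an inner minor moves a variable to that place
  in both monomials, where it can be cancelled. The property is preserved when two collections are
  glued along at most one vertex. Finally, simplicity makes the components of \<open>P\<close> touch each other
  in a treelike way: for two components touching in a vertex, the two other cells at that vertex are
  joined by a path outside \<open>P\<close>, and the closed curve so obtained separates the components, which
  is detected by the parity of crossings.
\<close>

subsection \<open>Chains of minors and potentials\<close>

definition potential :: "point set \<Rightarrow> (point \<Rightarrow> int) \<Rightarrow> bool" where
  "potential P f \<longleftrightarrow>
     (\<forall>(i, j)\<in>P. f (i, j) + f (Suc i, Suc j) = f (Suc i, j) + f (i, Suc j))"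

text \<open>
  The potentials are the integer functionals that vanish on all cell minors, so this is the
  saturation of the lattice congruence generated by the cells of \<open>P\<close>, described dually.
\<close>

definition potential_equiv :: "point set \<Rightarrow> point multiset \<Rightarrow> point multiset \<Rightarrow> bool" where
  "potential_equiv P U V \<longleftrightarrow>
     (\<forall>f. potential P f \<longrightarrow> (\<Sum>p\<in>#U. f p) = (\<Sum>p\<in>#V. f p))"

text \<open>A multiset of points stands for a monomial; the free cofactor \<open>U\<close> in
  \<open>minor_swap\<close> makes the relation a congruence.\<close>

inductive minor_equiv :: "point set \<Rightarrow> point multiset \<Rightarrow> point multiset \<Rightarrow> bool" for P where
  minor_refl: "minor_equiv P U U"
| minor_sym: "minor_equiv P U V \<Longrightarrow> minor_equiv P V U"
| minor_trans: "minor_equiv P U V \<Longrightarrow> minor_equiv P V W \<Longrightarrow> minor_equiv P U W"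
| minor_swap: "inner_interval P (i, j) (k, l) \<Longrightarrow>
    minor_equiv P (add_mset (i, j) (add_mset (k, l) U)) (add_mset (k, j) (add_mset (i, l) U))"

text \<open>The reverse implication always holds, by \<open>minor_equiv_imp_potential_equiv\<close>,
  so for saturated \<open>P\<close> the two relations coincide.\<close>

definition saturated :: "point set \<Rightarrow> bool" where
  "saturated P \<longleftrightarrow> (\<forall>U V. potential_equiv P U V \<longrightarrow> minor_equiv P U V)"

lemma potentialI:
  assumes "\<And>i j. (i, j) \<in> P \<Longrightarrow> f (i, j) + f (Suc i, Suc j) = f (Suc i, j) + f (i, Suc j)"
  shows "potential P f"
  using assms by (auto simp: potential_def)

lemma potentialD:
  "potential P f \<Longrightarrow> (i, j) \<in> P \<Longrightarrow> f (i, j) + f (Suc i, Suc j) = f (Suc i, j) + f (i, Suc j)"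
  by (auto simp: potential_def)

lemma potential_equivD:
  "potential_equiv P U V \<Longrightarrow> potential P f \<Longrightarrow> (\<Sum>p\<in>#U. f p) = (\<Sum>p\<in>#V. f p)"
  by (simp add: potential_equiv_def)

lemma inner_interval_iff:
  "inner_interval P (i, j) (k, l) \<longleftrightarrow>
     i < k \<and> j < l \<and> (\<forall>r s. i \<le> r \<and> r < k \<and> j \<le> s \<and> s < l \<longrightarrow> (r, s) \<in> P)"
  by (auto simp: inner_interval_def proper_interval_def interval_cells_def)

text \<open>The mixed second difference of \<open>f\<close> over a rectangle is the sum of those
  over its cells: a strip one cell high is summed from left to right, then the strips are
  stacked.\<close>

lemma potential_corners:
  assumes f: "potential P f" and I: "inner_interval P (i, j) (k, l)"
  shows "f (i, j) + f (k, l) = f (k, j) + f (i, l)"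
proof -
  have strip: "f (i, s) + f (r, Suc s) = f (r, s) + f (i, Suc s)"
    if "i \<le> r" "r \<le> k" "j \<le> s" "s < l" for r s
    using that
  proof (induction r rule: dec_induct)
    case (step r)
    then show ?case
      using potentialD[OF f, of r s] I unfolding inner_interval_iff by force
  qed auto
  have "f (i, j) + f (k, s) = f (k, j) + f (i, s)" if "j \<le> s" "s \<le> l" for s
    using that
  proof (induction s rule: dec_induct)
    case (step s)
    then show ?case
      using strip[of k s] I unfolding inner_interval_iff by force
  qed auto
  then show ?thesis
    using I unfolding inner_interval_iff by simp
qed

lemma minor_equiv_imp_potential_equiv:
  "minor_equiv P U V \<Longrightarrow> potential_equiv P U V"
  by (induction rule: minor_equiv.induct)
     (auto simp: potential_equiv_def dest: potential_corners)

lemma minor_equiv_add: "minor_equiv P U V \<Longrightarrow> minor_equiv P (U + M) (V + M)"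
  by (induction rule: minor_equiv.induct)
     (auto intro: minor_equiv.intros)

lemma minor_equiv_mono: "minor_equiv P U V \<Longrightarrow> P \<subseteq> Q \<Longrightarrow> minor_equiv Q U V"
proof (induction rule: minor_equiv.induct)
  case (minor_swap i j k l U)
  then show ?case
    by (intro minor_equiv.minor_swap) (auto simp: inner_interval_def)
qed (auto intro: minor_equiv.intros)

lemma minor_equiv_transpose:
  "minor_equiv P U V \<Longrightarrow>
     minor_equiv (prod.swap ` P) (image_mset prod.swap U) (image_mset prod.swap V)"
proof (induction rule: minor_equiv.induct)
  case (minor_swap i j k l U)
  then have "inner_interval (prod.swap ` P) (j, i) (l, k)"
    by (force simp: inner_interval_iff)
  then show ?case
    using minor_equiv.minor_swap[of "prod.swap ` P" j i l k "image_mset prod.swap U"]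
    by (simp add: add_mset_commute)
qed (auto intro: minor_equiv.intros)

text \<open>Reflection in the diagonal respects cells, inner intervals and potentials; this reduces
  column convexity to row convexity.\<close>

lemma saturated_transpose:
  assumes "saturated (prod.swap ` P)"
  shows "saturated P"
  unfolding saturated_def
proof (intro allI impI)
  fix U V
  assume UV: "potential_equiv P U V"
  have "potential_equiv (prod.swap ` P) (image_mset prod.swap U) (image_mset prod.swap V)"
    unfolding potential_equiv_def
  proof (intro allI impI)
    fix f
    assume f: "potential (prod.swap ` P) f"
    have "potential P (f \<circ> prod.swap)"
    proof (rule potentialI)
      fix i j assume "(i, j) \<in> P"
      then have "(j, i) \<in> prod.swap ` P" by force
      then show "(f \<circ> prod.swap) (i, j) + (f \<circ> prod.swap) (Suc i, Suc j) =
          (f \<circ> prod.swap) (Suc i, j) + (f \<circ> prod.swap) (i, Suc j)"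
        using potentialD[OF f, of j i] by simp
    qed
    from potential_equivD[OF UV this]
    show "(\<Sum>p\<in>#image_mset prod.swap U. f p) = (\<Sum>p\<in>#image_mset prod.swap V. f p)"
      by (simp add: image_mset.compositionality comp_def)
  qed
  with assms have "minor_equiv (prod.swap ` P) (image_mset prod.swap U) (image_mset prod.swap V)"
    by (simp add: saturated_def)
  from minor_equiv_transpose[OF this] show "minor_equiv P U V"
    by (simp add: image_mset.compositionality image_image)
qed

section \<open>Row convex and column convex collections\<close>

definition vertical_edge :: "point set \<Rightarrow> nat \<Rightarrow> nat \<Rightarrow> bool" where
  "vertical_edge P x t \<longleftrightarrow> (x, t) \<in> P \<or> (\<exists>i. x = Suc i \<and> (i, t) \<in> P)"

text \<open>The vertical segment between the two heights in column \<open>x\<close> consists of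
  edges of cells of \<open>P\<close>; \<open>min\<close> and \<open>max\<close> allow either height
  to be the lower one.\<close>

definition linked :: "point set \<Rightarrow> nat \<Rightarrow> nat \<Rightarrow> nat \<Rightarrow> bool" where
  "linked P x y y' \<longleftrightarrow> (\<forall>t. min y y' \<le> t \<and> t < max y y' \<longrightarrow> vertical_edge P x t)"

lemma linked_step:
  assumes "vertical_edge P x t"
  shows "linked P x y t \<longleftrightarrow> linked P x y (Suc t)"
proof -
  have "min y t \<le> u \<and> u < max y t \<longleftrightarrow> min y (Suc t) \<le> u \<and> u < max y (Suc t)" if "u \<noteq> t" for u
    using that by auto
  then show ?thesis
    using assms unfolding linked_def by metis
qed

lemma potential_row: "potential P (\<lambda>p. of_bool (snd p = y))"
  by (rule potentialI) simp

text \<open>The indicator of a vertical segment is constant on the left and on the right side of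
  each cell, and either diagonal has one vertex on each side.\<close>

lemma potential_segment: "potential P (\<lambda>p. of_bool (fst p = x \<and> linked P x y (snd p)))"
proof (rule potentialI)
  fix i j assume "(i, j) \<in> P"
  then have "vertical_edge P i j" "vertical_edge P (Suc i) j"
    by (auto simp: vertical_edge_def)
  then show "of_bool (fst (i, j) = x \<and> linked P x y (snd (i, j))) +
       of_bool (fst (Suc i, Suc j) = x \<and> linked P x y (snd (Suc i, Suc j))) =
      (of_bool (fst (Suc i, j) = x \<and> linked P x y (snd (Suc i, j))) +
       of_bool (fst (i, Suc j) = x \<and> linked P x y (snd (i, Suc j))) :: int)"
    using linked_step[of P i j y] linked_step[of P "Suc i" j y] by auto
qed

lemma sum_mset_of_bool: "(\<Sum>p\<in>#U. of_bool (Q p) :: int) = int (size (filter_mset Q U))"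
  by (induction U) auto

text \<open>An indicator that is a potential counts equally many points in \<open>U\<close> and in
  \<open>V\<close>.\<close>

lemma potential_equiv_ex_iff:
  assumes "potential_equiv P U V" "potential P (\<lambda>p. of_bool (Q p))"
  shows "(\<exists>p\<in>#U. Q p) \<longleftrightarrow> (\<exists>p\<in>#V. Q p)"
proof -
  have "size (filter_mset Q U) = size (filter_mset Q V)"
    using potential_equivD[OF assms] by (simp add: sum_mset_of_bool)
  then have "filter_mset Q U = {#} \<longleftrightarrow> filter_mset Q V = {#}"
    by (metis size_eq_0_iff_empty)
  then show ?thesis
    by (auto simp: multiset_eq_iff)
       (metis count_greater_zero_iff not_gr_zero)+
qed

text \<open>In each row between \<open>y\<close> and \<open>y'\<close> some cell of \<open>P\<close>
  borders column \<open>x\<close> and some cell borders column \<open>x'\<close>; row convexity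
  fills in the cells between them.\<close>

lemma row_convex_inner_interval:
  assumes "row_convex P" "linked P x y y'" "linked P x' y y'" "x < x'" "y < y'"
  shows "inner_interval P (x, y) (x', y')"
  unfolding inner_interval_iff
proof (intro conjI allI impI)
  fix r s assume rs: "x \<le> r \<and> r < x' \<and> y \<le> s \<and> s < y'"
  then have "vertical_edge P x s" "vertical_edge P x' s"
    using assms by (auto simp: linked_def)
  then obtain a b where ab: "(a, s) \<in> P" "(b, s) \<in> P" "a \<le> x" "x' \<le> Suc b"
    unfolding vertical_edge_def by fastforce
  then have "a \<le> r" "r \<le> b" using rs by auto
  with ab assms(1) show "(r, s) \<in> P"
    unfolding row_convex_def by (meson atLeastAtMost_iff le_trans)
qed (use assms in auto)

text \<open>The exchange argument of earliest-deadline-first scheduling.\<close>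
lemma row_convex_exchange:
  assumes P: "row_convex P"
    and p: "(x, y') \<in># U" "linked P x y y'" "y \<le> y'"
    and q: "(x', y) \<in># U" "linked P x' y y'"
  shows "\<exists>U'. minor_equiv P U U' \<and> (x, y) \<in># U'"
proof (cases "y = y' \<or> x = x'")
  case True
  then show ?thesis using p q by (auto intro: minor_equiv.minor_refl)
next
  case False
  with p have "y < y'" by simp
  obtain M where U: "U = add_mset (x, y') (add_mset (x', y) M)"
    using p(1) q(1) False by (metis insert_noteq_member multi_member_split prod.inject)
  let ?U = "add_mset (x, y) (add_mset (x', y') M)"
  have "minor_equiv P U ?U"
  \<comment> \<open>The old and the new pair are the two pairs of opposite corners of one rectangle;
    the order of the columns decides in which direction the swap is used.\<close>
  proof (cases "x < x'")
    case True
    then show ?thesis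
      using minor_equiv.minor_sym[OF minor_equiv.minor_swap[OF row_convex_inner_interval, OF P p(2) q(2) True \<open>y < y'\<close>, of M]]
      by (simp add: U add_mset_commute)
  next
    case x: False
    with False have "x' < x" by simp
    then show ?thesis
      using minor_equiv.minor_swap[OF row_convex_inner_interval, OF P q(2) p(2) _ \<open>y < y'\<close>, of M]
      by (simp add: U add_mset_commute)
  qed
  then show ?thesis by auto
qed

lemma row_convex_ex_common:
  assumes P: "finite P" "row_convex P" and UV: "potential_equiv P U V" and "U \<noteq> {#}"
  shows "\<exists>p U' V'. minor_equiv P U (add_mset p U') \<and> minor_equiv P V (add_mset p V')"
proof -
  have row: "(\<exists>p\<in>#U. snd p = y) \<longleftrightarrow> (\<exists>p\<in>#V. snd p = y)" for y
    by (rule potential_equiv_ex_iff[OF UV potential_row])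
  have seg: "(\<exists>p\<in>#U. fst p = x \<and> linked P x y (snd p)) \<longleftrightarrow>
      (\<exists>p\<in>#V. fst p = x \<and> linked P x y (snd p))" for x y
    by (rule potential_equiv_ex_iff[OF UV potential_segment])
  \<comment> \<open>Row indicators are potentials, so this lowest row is the same for
    \<open>U\<close> and \<open>V\<close>.\<close>
  define y where "y = Min (snd ` set_mset U)"
  have rows: "snd ` set_mset U = snd ` set_mset V"
    using row by (auto simp: set_eq_iff image_iff eq_commute)
  have y_le: "y \<le> snd p" if "p \<in># U \<or> p \<in># V" for p
    using that rows unfolding y_def by (auto intro!: Min_le)
  have "y \<in> snd ` set_mset U"
    unfolding y_def using \<open>U \<noteq> {#}\<close> by (intro Min_in) auto
  then obtain xu xv where xu: "(xu, y) \<in># U" and xv: "(xv, y) \<in># V"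
    using rows by (metis imageE prod.collapse)
  \<comment> \<open>The deadline of column \<open>x\<close>: the height at which the segment going
    up from row \<open>y\<close> ends, possibly \<open>y\<close> itself. It exists because
    \<open>P\<close> is finite.\<close>
  define d where "d x = (LEAST t. y \<le> t \<and> \<not> vertical_edge P x t)" for x
  have ex: "\<exists>t. y \<le> t \<and> \<not> vertical_edge P x t" for x
  proof -
    have "finite (snd ` P)" using P by simp
    then obtain N where "\<forall>t\<in>snd ` P. t < N"
      by (meson finite_nat_set_iff_bounded)
    then have "\<not> vertical_edge P x (max y N)"
      by (force simp: vertical_edge_def)
    then show ?thesis by (metis max.cobounded1)
  qed
  have linked_iff: "linked P x y t \<longleftrightarrow> t \<le> d x" if "y \<le> t" for x t
  proof
    assume "linked P x y t"
    then show "t \<le> d x"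
      using LeastI_ex[OF ex[of x]] that unfolding d_def[symmetric] linked_def
      by (metis max.absorb2 min.absorb1 not_le)
  next
    assume "t \<le> d x"
    then show "linked P x y t"
      using not_less_Least[of _ "\<lambda>t. y \<le> t \<and> \<not> vertical_edge P x t"] that
      unfolding d_def[symmetric] linked_def
      by (auto simp: min_def max_def)
  qed
  \<comment> \<open>The columns whose segment through row \<open>y\<close> carries a point of
    \<open>U\<close>; by \<open>seg\<close>, using \<open>V\<close> instead gives the same
    set.\<close>
  define X where "X = {x. \<exists>p\<in>#U. fst p = x \<and> linked P x y (snd p)}"
  have "linked P x y y" for x by (auto simp: linked_def)
  then have mem: "xu \<in> X" "xv \<in> X"
    using xu xv seg[of xu y] seg[of xv y] unfolding X_def by force+
  obtain x where x: "x \<in> X" and x_min: "\<And>z. z \<in> X \<Longrightarrow> d x \<le> d z"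
    using ex_has_least_nat[of "\<lambda>x. x \<in> X" xu d] mem by blast
  obtain yu where yu: "(x, yu) \<in># U" "linked P x y yu" using x by (force simp: X_def)
  obtain yv where yv: "(x, yv) \<in># V" "linked P x y yv"
    using x seg[of x y] by (force simp: X_def)
  \<comment> \<open>By the choice of \<open>x\<close>, \<open>yu\<close> and \<open>yv\<close> are
    at most \<open>d x\<close>, which is at most \<open>d xu\<close> and \<open>d xv\<close>; so the
    segments in the columns \<open>xu\<close> and \<open>xv\<close> are long enough for the
    exchange.\<close>
  have "linked P xu y yu" "linked P xv y yv"
    using yu yv y_le[of "(x, yu)"] y_le[of "(x, yv)"] x_min[OF mem(1)] x_min[OF mem(2)]
    by (simp_all add: linked_iff)
  then obtain U' V' where "minor_equiv P U U'" "(x, y) \<in># U'" "minor_equiv P V V'" "(x, y) \<in># V'"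
    using row_convex_exchange[OF P(2) yu _ xu] row_convex_exchange[OF P(2) yv _ xv]
      y_le[of "(x, yu)"] y_le[of "(x, yv)"] yu(1) yv(1) by auto
  then show ?thesis by (metis multi_member_split)
qed

lemma potential_equiv_size: "potential_equiv P U V \<Longrightarrow> size U = size V"
  using potential_equivD[of P U V "\<lambda>_. 1"] by (simp add: potential_def)

text \<open>Induction on the degree: both monomials are moved to ones with a common point
  \<open>p\<close>, which potential equivalence allows to cancel because it compares integer
  sums.\<close>

lemma saturated_row_convex:
  assumes "finite P" "row_convex P"
  shows "saturated P"
proof -
  have "minor_equiv P U V" if "potential_equiv P U V" for U V
    using that
  proof (induction "size U" arbitrary: U V)
    case 0
    then show ?case
      using potential_equiv_size[of P U V] by (simp add: minor_equiv.minor_refl)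
  next
    case (Suc n)
    then have "U \<noteq> {#}" by auto
    from row_convex_ex_common[OF assms Suc.prems this] obtain p U' V'
      where U: "minor_equiv P U (add_mset p U')" and V: "minor_equiv P V (add_mset p V')"
      by blast
    note U1 = minor_equiv_imp_potential_equiv[OF U] and V1 = minor_equiv_imp_potential_equiv[OF V]
    have eq: "potential_equiv P U' V'"
      using Suc.prems U1 V1 by (auto simp: potential_equiv_def)
    have "n = size U'"
      using potential_equiv_size[OF U1] Suc.hyps(2) by simp
    from Suc.hyps(1)[OF this eq] have "minor_equiv P (add_mset p U') (add_mset p V')"
      using minor_equiv_add[of P U' V' "{#p#}"] by simp
    with U V show ?case by (meson minor_equiv.minor_sym minor_equiv.minor_trans)
  qed
  then show ?thesis by (simp add: saturated_def)
qed

lemma transpose_mem_iff: "(i, j) \<in> prod.swap ` P \<longleftrightarrow> (j, i) \<in> P"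
  by force

lemma saturated_column_convex:
  assumes "finite P" "column_convex P"
  shows "saturated P"
proof (rule saturated_transpose, rule saturated_row_convex)
  show "row_convex (prod.swap ` P)"
    using assms(2) unfolding row_convex_def column_convex_def transpose_mem_iff by metis
qed (use assms in simp)

section \<open>Gluing two saturated collections at a vertex\<close>

lemma cell_vertices_eq:
  "cell_vertices (i, j) = {(i, j), (Suc i, j), (i, Suc j), (Suc i, Suc j)}"
  unfolding cell_vertices_def by (auto simp: less_eq_prod_def)

lemma in_vertices_iff: "v \<in> vertices P \<longleftrightarrow> (\<exists>(i, j)\<in>P. v \<in> cell_vertices (i, j))"
  by (auto simp: vertices_def)

lemma vertices_cell:
  assumes "(i, j) \<in> P"
  shows "(i, j) \<in> vertices P" "(Suc i, j) \<in> vertices P"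
    "(i, Suc j) \<in> vertices P" "(Suc i, Suc j) \<in> vertices P"
  using assms by (auto simp: in_vertices_iff cell_vertices_eq intro!: bexI[of _ "(i, j)"])

lemma sum_mset_filter_split:
  "(\<Sum>p\<in>#U. if Q p then f p else (g p :: int)) =
     (\<Sum>p\<in>#filter_mset Q U. f p) + (\<Sum>p\<in>#filter_mset (\<lambda>p. \<not> Q p) U. g p)"
  by (induction U) auto

lemma sum_mset_diff_const: "(\<Sum>p\<in>#U. f p - (c :: int)) = (\<Sum>p\<in>#U. f p) - int (size U) * c"
  by (induction U) (auto simp: algebra_simps)

text \<open>A potential on one part extends by a constant to the other, since they share at most
  \<open>v\<close>. Hence the points of \<open>A\<close> apart from \<open>v\<close>, balanced in
  number by copies of \<open>v\<close>, are equivalent over \<open>A\<close>, and all remaining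
  points over \<open>B\<close>.\<close>

lemma saturated_glue_aux:
  assumes A: "saturated A" and B: "saturated B"
    and AB: "vertices A \<inter> vertices B \<subseteq> {v}"
    and UV: "potential_equiv (A \<union> B) U V"
    and le: "size (filter_mset (\<lambda>p. p \<in> vertices A - {v}) U) \<le>
             size (filter_mset (\<lambda>p. p \<in> vertices A - {v}) V)"
  shows "minor_equiv (A \<union> B) U V"
proof -
  define Q where "Q = (\<lambda>p. p \<in> vertices A - {v})"
  \<comment> \<open>The copies of \<open>v\<close> that make up for the missing points of
    \<open>U\<close>; by \<open>le\<close> the difference is not truncated.\<close>
  define T where "T = replicate_mset (size (filter_mset Q V) - size (filter_mset Q U)) v"
  let ?U = "filter_mset Q U" and ?V = "filter_mset Q V"
  let ?U' = "filter_mset (\<lambda>p. \<not> Q p) U" and ?V' = "filter_mset (\<lambda>p. \<not> Q p) V"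
  have T: "(\<Sum>p\<in>#T. f p) = (int (size ?V) - int (size ?U)) * f v" for f :: "point \<Rightarrow> int"
    using le unfolding T_def Q_def by (simp add: of_nat_diff)
  have "potential_equiv A (?U + T) ?V"
    unfolding potential_equiv_def
  proof (intro allI impI)
    fix f assume f: "potential A f"
    \<comment> \<open>After subtracting \<open>f v\<close> the potential vanishes at
      \<open>v\<close>, so it continues as zero on \<open>B\<close>. The subtracted constants
      account for \<open>T\<close>.\<close>
    have "potential (A \<union> B) (\<lambda>p. if Q p then f p - f v else 0)" (is "potential _ ?g")
    proof (rule potentialI)
      fix i j assume "(i, j) \<in> A \<union> B"
      then show "?g (i, j) + ?g (Suc i, Suc j) = ?g (Suc i, j) + ?g (i, Suc j)"
      proof
        assume ij: "(i, j) \<in> A"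
        have "?g p = f p - f v" if "p \<in> vertices A" for p
          using that by (auto simp: Q_def)
        with vertices_cell[OF ij] potentialD[OF f ij] show ?thesis by simp
      next
        assume ij: "(i, j) \<in> B"
        have "?g p = 0" if "p \<in> vertices B" for p
          using that AB by (auto simp: Q_def)
        with vertices_cell[OF ij] show ?thesis by simp
      qed
    qed
    from potential_equivD[OF UV this]
    show "(\<Sum>p\<in>#?U + T. f p) = (\<Sum>p\<in>#?V. f p)"
      by (simp add: sum_mset_filter_split T sum_mset_diff_const algebra_simps)
  qed
  with A have 1: "minor_equiv (A \<union> B) (?U + T) ?V"
    by (auto simp: saturated_def intro: minor_equiv_mono)
  have "potential_equiv B ?U' (?V' + T)"
    unfolding potential_equiv_def
  proof (intro allI impI)
    fix f assume f: "potential B f"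
    \<comment> \<open>Here \<open>f\<close> is continued from \<open>v\<close> to all of
      \<open>A\<close> as the constant \<open>f v\<close>.\<close>
    have "potential (A \<union> B) (\<lambda>p. if Q p then f v else f p)" (is "potential _ ?g")
    proof (rule potentialI)
      fix i j assume "(i, j) \<in> A \<union> B"
      then show "?g (i, j) + ?g (Suc i, Suc j) = ?g (Suc i, j) + ?g (i, Suc j)"
      proof
        assume ij: "(i, j) \<in> A"
        have "?g p = f v" if "p \<in> vertices A" for p
          using that by (auto simp: Q_def)
        with vertices_cell[OF ij] show ?thesis by simp
      next
        assume ij: "(i, j) \<in> B"
        have "?g p = f p" if "p \<in> vertices B" for p
          using that AB by (auto simp: Q_def)
        with vertices_cell[OF ij] potentialD[OF f ij] show ?thesis by simp
      qed
    qed
    from potential_equivD[OF UV this]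
    show "(\<Sum>p\<in>#?U'. f p) = (\<Sum>p\<in>#?V' + T. f p)"
      by (simp add: sum_mset_filter_split T algebra_simps)
  qed
  with B have 2: "minor_equiv (A \<union> B) ?U' (?V' + T)"
    by (auto simp: saturated_def intro: minor_equiv_mono)
  have "minor_equiv (A \<union> B) (?U' + ?U) (?V' + T + ?U)"
    by (rule minor_equiv_add[OF 2])
  moreover have "minor_equiv (A \<union> B) (?U + T + ?V') (?V + ?V')"
    by (rule minor_equiv_add[OF 1])
  moreover have "?U' + ?U = U" "?V + ?V' = V" "?V' + T + ?U = ?U + T + ?V'"
    using multiset_partition[of U Q] multiset_partition[of V Q] by (simp_all add: ac_simps)
  ultimately show ?thesis
    by (metis minor_equiv.minor_trans)
qed

lemma saturated_glue:
  assumes "saturated A" "saturated B" "vertices A \<inter> vertices B \<subseteq> {v}"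
  shows "saturated (A \<union> B)"
  unfolding saturated_def
proof (intro allI impI)
  fix U V assume UV: "potential_equiv (A \<union> B) U V"
  then have VU: "potential_equiv (A \<union> B) V U" by (simp add: potential_equiv_def)
  show "minor_equiv (A \<union> B) U V"
    using saturated_glue_aux[OF assms UV] saturated_glue_aux[OF assms VU]
    by (meson le_cases minor_equiv.minor_sym)
qed

subsection \<open>Gluing along a tree of components\<close>

definition touching_cells :: "point set \<Rightarrow> (point \<times> point) set" where
  "touching_cells P = {(C, D). C \<in> P \<and> D \<in> P \<and> cell_vertices C \<inter> cell_vertices D \<noteq> {}}"

text \<open>Each contact between cells of different components is a bridge of the graph of touching
  cells. Both ordered pairs are removed because the relation is symmetric.\<close>

definition treelike :: "point set \<Rightarrow> bool" where
  "treelike P \<longleftrightarrow>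
     (\<forall>(C, D) \<in> touching_cells P - connected_cells P.
        (C, D) \<notin> (touching_cells P - {(C, D), (D, C)})\<^sup>*)"

section \<open>Adjacency and contact of cells in coordinates\<close>

lemma cell_edges_eq:
  "cell_edges (i, j) =
     {{(i, j), (Suc i, j)}, {(i, j), (i, Suc j)},
      {(Suc i, j), (Suc i, Suc j)}, {(i, Suc j), (Suc i, Suc j)}}"
  by (simp add: cell_edges_def)

lemma Int_nonempty_iff: "A \<inter> B \<noteq> {} \<longleftrightarrow> (\<exists>x\<in>A. x \<in> B)" by auto

lemma adjacent_cells_iff:
  "((i, j), (k, l)) \<in> adjacent_cells P \<longleftrightarrow>
     (i, j) \<in> P \<and> (k, l) \<in> P \<and>
     (i = k \<and> (j = l \<or> l = Suc j \<or> j = Suc l) \<or> j = l \<and> (k = Suc i \<or> i = Suc k))"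
proof -
  have "cell_edges (i, j) \<inter> cell_edges (k, l) \<noteq> {} \<longleftrightarrow>
     (i = k \<and> (j = l \<or> l = Suc j \<or> j = Suc l) \<or> j = l \<and> (k = Suc i \<or> i = Suc k))"
    (is "?L \<longleftrightarrow> ?R")
  proof
    assume ?L
    then show ?R
      unfolding Int_nonempty_iff cell_edges_eq
      by (simp add: doubleton_eq_iff) (elim disjE conjE; simp)
  next
    assume ?R
    then show ?L
      unfolding Int_nonempty_iff cell_edges_eq by (elim disjE conjE) (auto simp: doubleton_eq_iff)
  qed
  then show ?thesis by (auto simp: adjacent_cells_def)
qed

lemma mem_cell_vertices_iff:
  "(x, y) \<in> cell_vertices (i, j) \<longleftrightarrow> i \<le> x \<and> x \<le> Suc i \<and> j \<le> y \<and> y \<le> Suc j"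
  by (auto simp: cell_vertices_def)

lemma touching_cells_iff:
  "((i, j), (k, l)) \<in> touching_cells P \<longleftrightarrow>
     (i, j) \<in> P \<and> (k, l) \<in> P \<and> i \<le> Suc k \<and> k \<le> Suc i \<and> j \<le> Suc l \<and> l \<le> Suc j"
proof -
  have "cell_vertices (i, j) \<inter> cell_vertices (k, l) \<noteq> {} \<longleftrightarrow>
      i \<le> Suc k \<and> k \<le> Suc i \<and> j \<le> Suc l \<and> l \<le> Suc j" (is "?L \<longleftrightarrow> ?R")
  proof
    assume ?L
    then obtain x y where "(x, y) \<in> cell_vertices (i, j)" "(x, y) \<in> cell_vertices (k, l)"
      by auto
    then show ?R unfolding mem_cell_vertices_iff by linarith
  next
    assume ?R
    then have "(max i k, max j l) \<in> cell_vertices (i, j)" "(max i k, max j l) \<in> cell_vertices (k, l)"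
      by (auto simp: mem_cell_vertices_iff)
    then show ?L by blast
  qed
  then show ?thesis by (auto simp: touching_cells_def)
qed

lemma sym_adjacent_cells: "sym (adjacent_cells P)"
  by (auto simp: adjacent_cells_def sym_def)

lemma sym_touching_cells: "sym (touching_cells P)"
  by (auto simp: touching_cells_def sym_def)

lemma adjacent_cells_mono: "P \<subseteq> Q \<Longrightarrow> adjacent_cells P \<subseteq> adjacent_cells Q"
  by (auto simp: adjacent_cells_def)

section \<open>Separation by crossing parity\<close>

text \<open>
  For a path from \<open>E\<close> to \<open>F\<close> avoiding \<open>P\<close>, the witness \<open>c X\<close> is the parity of the number of steps
  that the path makes between the row of \<open>X\<close> and the next row, to the right of \<open>X\<close>.
\<close>
definition crossing_parity :: "point set \<Rightarrow> point \<Rightarrow> point \<Rightarrow> (point \<Rightarrow> bool) \<Rightarrow> bool" where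
  "crossing_parity P E F c \<longleftrightarrow>
     (\<forall>a b. (a, b) \<in> P \<longrightarrow> (Suc a, b) \<in> P \<longrightarrow> c (a, b) = c (Suc a, b)) \<and>
     (\<forall>a b a'. (a, b) \<in> P \<longrightarrow> (a', Suc b) \<in> P \<longrightarrow> a \<le> Suc a' \<longrightarrow> a' \<le> Suc a \<longrightarrow>
       (c (a, b) \<noteq> c (a', Suc b)) =
       ((snd E = Suc b \<and> a' < fst E) \<noteq> (snd F = Suc b \<and> a' < fst F)))"

lemma crossing_parity_hor:
  "crossing_parity P E F c \<Longrightarrow> (a, b) \<in> P \<Longrightarrow> (Suc a, b) \<in> P \<Longrightarrow> c (a, b) = c (Suc a, b)"
  unfolding crossing_parity_def by blast

lemma crossing_parity_ver:
  assumes "crossing_parity P E F c" "(a, b) \<in> P" "(a', Suc b) \<in> P" "a \<le> Suc a'" "a' \<le> Suc a"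
  shows "(c (a, b) \<noteq> c (a', Suc b)) =
    ((snd E = Suc b \<and> a' < fst E) \<noteq> (snd F = Suc b \<and> a' < fst F))"
  using assms unfolding crossing_parity_def by blast

text \<open>Induction along the path. The rule for consecutive rows reflects that the path can enter
  or leave the ray to the right of \<open>(a', Suc b)\<close> only by vertical steps, so the
  crossings below and above this ray have equal parity unless exactly one end of the path lies on
  it.\<close>

lemma ex_crossing_parity:
  assumes "(E, F) \<in> (adjacent_cells N)\<^sup>*" and N: "N \<inter> P = {}"
  shows "\<exists>c. crossing_parity P E F c"
  using assms(1)
proof (induction rule: rtrancl_induct)
  case base
  have "crossing_parity P E E (\<lambda>_. False)" by (simp add: crossing_parity_def)
  then show ?case by blast
next
  case (step Y Z)
  obtain c where c: "crossing_parity P E Y c"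
    using step.IH by blast
  obtain r s r' s' where YZ: "Y = (r, s)" "Z = (r', s')" by fastforce
  have nP: "(r, s) \<notin> P" "(r', s') \<notin> P"
    using step.hyps(2) N by (auto simp: YZ adjacent_cells_iff)
  have adj: "r = r' \<and> (s = s' \<or> s' = Suc s \<or> s = Suc s') \<or> s = s' \<and> (r' = Suc r \<or> r = Suc r')"
    using step.hyps(2) by (simp add: YZ adjacent_cells_iff)
  \<comment> \<open>The contribution of the new step: it counts for the cells of its lower row to
    its left, and a horizontal step counts for none.\<close>
  define \<chi> where "\<chi> = (\<lambda>(a, b). s \<noteq> s' \<and> min s s' = b \<and> a < r)"
  have "crossing_parity P E Z (\<lambda>X. c X \<noteq> \<chi> X)"
    unfolding crossing_parity_def
  proof (intro conjI allI impI)
    fix a b assume *: "(a, b) \<in> P" "(Suc a, b) \<in> P"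
    then have "(Suc a, b) \<noteq> (r, s)" "(Suc a, b) \<noteq> (r', s')" using nP by auto
    then have "\<chi> (a, b) = \<chi> (Suc a, b)"
      using adj unfolding \<chi>_def by (elim disjE conjE) auto
    with crossing_parity_hor[OF c *]
    show "(c (a, b) \<noteq> \<chi> (a, b)) = (c (Suc a, b) \<noteq> \<chi> (Suc a, b))" by simp
  next
    fix a b a'
    assume *: "(a, b) \<in> P" "(a', Suc b) \<in> P" "a \<le> Suc a'" "a' \<le> Suc a"
    then have "(a, b) \<noteq> (r, s)" "(a, b) \<noteq> (r', s')" "(a', Suc b) \<noteq> (r, s)" "(a', Suc b) \<noteq> (r', s')"
      using nP by auto
    then have "(\<chi> (a, b) \<noteq> \<chi> (a', Suc b)) = ((s = Suc b \<and> a' < r) \<noteq> (s' = Suc b \<and> a' < r'))"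
      using adj *(3,4) unfolding \<chi>_def by (elim disjE conjE) auto
    with crossing_parity_ver[OF c *]
    show "((c (a, b) \<noteq> \<chi> (a, b)) \<noteq> (c (a', Suc b) \<noteq> \<chi> (a', Suc b))) =
      ((snd E = Suc b \<and> a' < fst E) \<noteq> (snd Z = Suc b \<and> a' < fst Z))"
      unfolding YZ fst_conv snd_conv by argo
  qed
  then show ?case by blast
qed

text \<open>\<open>c\<close> is a two-colouring that is constant along all contacts other than the
  one between \<open>C\<close> and \<open>D\<close>, so a chain avoiding that contact keeps its
  colour.\<close>

lemma not_reachable_if_separated:
  assumes hor: "\<And>a b. (a, b) \<in> P \<Longrightarrow> (Suc a, b) \<in> P \<Longrightarrow> c (a, b) = c (Suc a, b)"
    and ver: "\<And>a b a'. (a, b) \<in> P \<Longrightarrow> (a', Suc b) \<in> P \<Longrightarrow> a \<le> Suc a' \<Longrightarrow> a' \<le> Suc a \<Longrightarrow>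
      ((a, b), (a', Suc b)) \<noteq> (C, D) \<Longrightarrow> c (a, b) = c (a', Suc b)"
    and sep: "c C \<noteq> (c D :: bool)"
  shows "(C, D) \<notin> (touching_cells P - {(C, D), (D, C)})\<^sup>*"
proof
  assume "(C, D) \<in> (touching_cells P - {(C, D), (D, C)})\<^sup>*"
  then have "c C = c D"
  proof (induction rule: rtrancl_induct)
    case (step Y Z)
    obtain i j k l where YZ: "Y = (i, j)" "Z = (k, l)" by fastforce
    from step.hyps(2) have *: "(i, j) \<in> P" "(k, l) \<in> P" "i \<le> Suc k" "k \<le> Suc i" "j \<le> Suc l" "l \<le> Suc j"
      "(Y, Z) \<noteq> (C, D)" "(Z, Y) \<noteq> (C, D)"
      by (auto simp: YZ touching_cells_iff)
    consider "l = Suc j" | "j = Suc l" | "j = l" "k = Suc i" | "j = l" "i = Suc k" | "i = k" "j = l"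
      using *(3-6) by (auto simp: le_Suc_eq)
    then have "c Y = c Z"
      using * hor[of i j] hor[of k l] ver[of i j k] ver[of k l i] by cases (auto simp: YZ)
    with step.IH show ?case by simp
  qed simp
  with sep show False by simp
qed

text \<open>The path outside \<open>P\<close> is closed by a diagonal step across the common vertex
  of \<open>C\<close> and \<open>D\<close>. The parity of crossings with this closed curve changes
  between \<open>C\<close> and \<open>D\<close> and at no other contact.\<close>

lemma diagonal_not_reachable:
  assumes "(i, j) \<in> P" "(Suc i, Suc j) \<in> P" and N: "N \<inter> P = {}"
    and "(Suc i, j) \<notin> P" "(i, Suc j) \<notin> P"
    and path: "((Suc i, j), (i, Suc j)) \<in> (adjacent_cells N)\<^sup>*"
    and CD: "C = (i, j)" "D = (Suc i, Suc j)"
  shows "(C, D) \<notin> (touching_cells P - {(C, D), (D, C)})\<^sup>*"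
proof -
  obtain c where c: "crossing_parity P (Suc i, j) (i, Suc j) c"
    using ex_crossing_parity[OF path N] by blast
  note hor = crossing_parity_hor[OF c] and ver = crossing_parity_ver[OF c, unfolded fst_conv snd_conv]
  have neq: "X \<noteq> (Suc i, j)" "X \<noteq> (i, Suc j)" if "X \<in> P" for X
    using that assms by auto
  \<comment> \<open>The contribution of the closing step between rows \<open>j\<close> and
    \<open>Suc j\<close>: its lower end \<open>(Suc i, j)\<close> is to the right of the cells with
    \<open>a < Suc i\<close>.\<close>
  define \<delta> where "\<delta> = (\<lambda>(a, b). b = j \<and> a \<le> i)"
  show ?thesis
  proof (rule not_reachable_if_separated[where c = "\<lambda>X. c X \<noteq> \<delta> X"])
    fix a b assume *: "(a, b) \<in> P" "(Suc a, b) \<in> P"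
    have "\<delta> (a, b) = \<delta> (Suc a, b)"
      using neq[OF *(2)] by (auto simp: \<delta>_def)
    with hor[OF *] show "(c (a, b) \<noteq> \<delta> (a, b)) = (c (Suc a, b) \<noteq> \<delta> (Suc a, b))" by simp
  next
    fix a b a'
    assume *: "(a, b) \<in> P" "(a', Suc b) \<in> P" "a \<le> Suc a'" "a' \<le> Suc a"
      and ne: "((a, b), (a', Suc b)) \<noteq> (C, D)"
    have "(\<delta> (a, b) \<noteq> \<delta> (a', Suc b)) = ((j = Suc b \<and> a' < Suc i) \<noteq> (Suc j = Suc b \<and> a' < i))"
    proof (cases "b = j")
      case True
      with neq[OF *(1)] neq[OF *(2)] ne have "\<not> (a = Suc i)" "\<not> (a' = i)" "\<not> (a = i \<and> a' = Suc i)"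
        by (auto simp: CD)
      with *(3,4) have "a \<le> i \<longleftrightarrow> a' < i" by linarith
      with True show ?thesis by (simp add: \<delta>_def)
    qed (auto simp: \<delta>_def)
    with ver[OF *] show "(c (a, b) \<noteq> \<delta> (a, b)) = (c (a', Suc b) \<noteq> \<delta> (a', Suc b))" by blast
  next
    \<comment> \<open>The path alone gives \<open>C\<close> and \<open>D\<close> the same parity;
      the closing step separates them.\<close>
    show "(c C \<noteq> \<delta> C) \<noteq> (c D \<noteq> \<delta> D)"
      using ver[of i j "Suc i"] assms(1,2) by (auto simp: \<delta>_def CD)
  qed
qed

text \<open>The mirror image. The closing step now has lower end \<open>(i, j)\<close>, whence the
  strict bound in \<open>\<delta>\<close>. It counts for neither \<open>C\<close> nor
  \<open>D\<close>; what separates them is the end \<open>(Suc i, Suc j)\<close> of the path, to the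
  right of \<open>D\<close>.\<close>

lemma antidiagonal_not_reachable:
  assumes "(Suc i, j) \<in> P" "(i, Suc j) \<in> P" and N: "N \<inter> P = {}"
    and "(i, j) \<notin> P" "(Suc i, Suc j) \<notin> P"
    and path: "((i, j), (Suc i, Suc j)) \<in> (adjacent_cells N)\<^sup>*"
    and CD: "C = (Suc i, j)" "D = (i, Suc j)"
  shows "(C, D) \<notin> (touching_cells P - {(C, D), (D, C)})\<^sup>*"
proof -
  obtain c where c: "crossing_parity P (i, j) (Suc i, Suc j) c"
    using ex_crossing_parity[OF path N] by blast
  note hor = crossing_parity_hor[OF c] and ver = crossing_parity_ver[OF c, unfolded fst_conv snd_conv]
  have neq: "X \<noteq> (i, j)" "X \<noteq> (Suc i, Suc j)" if "X \<in> P" for X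
    using that assms by auto
  define \<delta> where "\<delta> = (\<lambda>(a, b). b = j \<and> a < i)"
  show ?thesis
  proof (rule not_reachable_if_separated[where c = "\<lambda>X. c X \<noteq> \<delta> X"])
    fix a b assume *: "(a, b) \<in> P" "(Suc a, b) \<in> P"
    have "\<delta> (a, b) = \<delta> (Suc a, b)"
      using neq[OF *(1)] neq[OF *(2)] by (auto simp: \<delta>_def)
    with hor[OF *] show "(c (a, b) \<noteq> \<delta> (a, b)) = (c (Suc a, b) \<noteq> \<delta> (Suc a, b))" by simp
  next
    fix a b a'
    assume *: "(a, b) \<in> P" "(a', Suc b) \<in> P" "a \<le> Suc a'" "a' \<le> Suc a"
      and ne: "((a, b), (a', Suc b)) \<noteq> (C, D)"
    have "(\<delta> (a, b) \<noteq> \<delta> (a', Suc b)) = ((j = Suc b \<and> a' < i) \<noteq> (Suc j = Suc b \<and> a' < Suc i))"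
    proof (cases "b = j")
      case True
      with neq[OF *(1)] neq[OF *(2)] ne have "\<not> (a = i)" "\<not> (a' = Suc i)" "\<not> (a = Suc i \<and> a' = i)"
        by (auto simp: CD)
      with *(3,4) have "a < i \<longleftrightarrow> a' < Suc i" by linarith
      with True show ?thesis by (simp add: \<delta>_def)
    qed (auto simp: \<delta>_def)
    with ver[OF *] show "(c (a, b) \<noteq> \<delta> (a, b)) = (c (a', Suc b) \<noteq> \<delta> (a', Suc b))" by blast
  next
    show "(c C \<noteq> \<delta> C) \<noteq> (c D \<noteq> \<delta> D)"
      using ver[of "Suc i" j i] assms(1,2) by (auto simp: \<delta>_def CD)
  qed
qed

section \<open>The complement of a simple collection in its frame\<close>

lemma horizontal_path:
  assumes "r \<le> r'" "\<And>k. r \<le> k \<Longrightarrow> k \<le> r' \<Longrightarrow> (k, s) \<in> N"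
  shows "((r, s), (r', s)) \<in> (adjacent_cells N)\<^sup>*"
  using assms
proof (induction r' rule: dec_induct)
  case (step n)
  then have "((n, s), (Suc n, s)) \<in> adjacent_cells N"
    by (simp add: adjacent_cells_iff)
  with step show ?case by (meson le_SucI rtrancl.rtrancl_into_rtrancl)
qed simp

lemma vertical_path:
  assumes "s \<le> s'" "\<And>k. s \<le> k \<Longrightarrow> k \<le> s' \<Longrightarrow> (r, k) \<in> N"
  shows "((r, s), (r, s')) \<in> (adjacent_cells N)\<^sup>*"
  using assms
proof (induction s' rule: dec_induct)
  case (step n)
  then have "((r, n), (r, Suc n)) \<in> adjacent_cells N"
    by (simp add: adjacent_cells_iff)
  with step show ?case by (meson le_SucI rtrancl.rtrancl_into_rtrancl)
qed simp

text \<open>At most four cells contain a given vertex, so the frame condition puts all of them into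
  the interval; this is applied to the lower left and the upper right vertex of the cell.\<close>

lemma frame_interior:
  assumes fr: "frame P a b" and rs: "(r, s) \<in> P"
  shows "fst a < r" "Suc r < fst b" "snd a < s" "Suc s < snd b"
proof -
  let ?S = "\<lambda>v. {C \<in> interval_cells a b. v \<in> cell_vertices C}"
  have full: "T \<subseteq> interval_cells a b \<and> card T = 4"
    if "v \<in> vertices P" "?S v \<subseteq> T" "finite T" "card T \<le> 4" for v T
  proof -
    have "card (?S v) = 4" using fr that(1) by (auto simp: frame_def)
    then have "?S v = T" using that by (metis (no_types, lifting) card_mono card_subset_eq le_antisym)
    with \<open>card (?S v) = 4\<close> show ?thesis by auto
  qed
  let ?T = "{(r, s), (r - 1, s), (r, s - 1), (r - 1, s - 1)}"
  have "?T \<subseteq> interval_cells a b \<and> card ?T = 4"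
  proof (rule full[of "(r, s)"])
    show "?S (r, s) \<subseteq> ?T" by (auto simp: cell_vertices_eq)
    show "card ?T \<le> 4" by (simp add: card_insert_if)
  qed (use vertices_cell[OF rs] in auto)
  \<comment> \<open>If \<open>r\<close> or \<open>s\<close> were 0, truncated subtraction would make
    elements of \<open>?T\<close> coincide; cardinality four excludes this.\<close>
  moreover from this have "r - 1 \<noteq> r" "s - 1 \<noteq> s"
    by (auto simp: card_insert_if split: if_splits)
  ultimately show "fst a < r" "snd a < s" by (auto simp: interval_cells_def)
  let ?T' = "{(r, s), (Suc r, s), (r, Suc s), (Suc r, Suc s)}"
  have "?T' \<subseteq> interval_cells a b \<and> card ?T' = 4"
  proof (rule full[of "(Suc r, Suc s)"])
    show "?S (Suc r, Suc s) \<subseteq> ?T'" by (auto simp: cell_vertices_eq)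
    show "card ?T' \<le> 4" by (simp add: card_insert_if)
  qed (use vertices_cell[OF rs] in auto)
  then show "Suc r < fst b" "Suc s < snd b" by (auto simp: interval_cells_def)
qed

text \<open>The cells of \<open>P\<close> keep away from the border, so one can walk from the corner
  cell \<open>a\<close> along the border, first on a side through \<open>a\<close> and then on the
  next one.\<close>

lemma border_path:
  assumes fr: "frame P a b" and D: "D \<in> border_cells a b"
  shows "(a, D) \<in> (adjacent_cells (- P))\<^sup>*"
proof -
  obtain r s where rs: "D = (r, s)" by fastforce
  obtain a1 a2 where a: "a = (a1, a2)" by fastforce
  note int = frame_interior[OF fr, unfolded a, simplified]
  have N: "(x, y) \<in> - P" if "x \<le> a1 \<or> fst b \<le> Suc x \<or> y \<le> a2 \<or> snd b \<le> Suc y" for x y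
    using int[of x y] that by auto
  have le: "a1 \<le> r" "a2 \<le> s" using D by (auto simp: border_cells_def interval_cells_def rs a)
  consider "r = a1 \<or> snd b \<le> Suc s" | "s = a2 \<or> fst b \<le> Suc r"
    using D by (auto simp: border_cells_def rs a)
  then show ?thesis
  proof cases
    case 1
    have "((a1, a2), (a1, s)) \<in> (adjacent_cells (- P))\<^sup>*"
      using le N by (intro vertical_path) auto
    also have "((a1, s), (r, s)) \<in> (adjacent_cells (- P))\<^sup>*"
      using le N 1 by (intro horizontal_path) auto
    finally show ?thesis by (simp add: rs a)
  next
    case 2
    have "((a1, a2), (r, a2)) \<in> (adjacent_cells (- P))\<^sup>*"
      using le N by (intro horizontal_path) auto
    also have "((r, a2), (r, s)) \<in> (adjacent_cells (- P))\<^sup>*"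
      using le N 2 by (intro vertical_path) auto
    finally show ?thesis by (simp add: rs a)
  qed
qed

text \<open>Simplicity leads each cell to the border, and all border cells are joined to the corner
  cell \<open>a\<close>.\<close>

lemma complement_connected:
  assumes fr: "frame P a b" and sf: "simple_in_frame P a b"
    and E: "E \<in> interval_cells a b - P" and F: "F \<in> interval_cells a b - P"
  shows "(E, F) \<in> (adjacent_cells (- P))\<^sup>*"
proof -
  have "adjacent_cells (interval_cells a b - P) \<subseteq> adjacent_cells (- P)"
    by (rule adjacent_cells_mono) auto
  from rtrancl_mono[OF this] have *: "(a, C) \<in> (adjacent_cells (- P))\<^sup>*"
    if "C \<in> interval_cells a b - P" for C
    using that sf border_path[OF fr] sym_rtrancl[OF sym_adjacent_cells]
    unfolding simple_in_frame_def by (meson rtrancl_trans subsetD symD)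
  show ?thesis
    using *[OF E] *[OF F] sym_rtrancl[OF sym_adjacent_cells] by (meson rtrancl_trans symD)
qed

section \<open>Simple collections are treelike\<close>

lemma connected_cells_adjacent:
  assumes "(C, D) \<in> adjacent_cells P"
  shows "(C, D) \<in> connected_cells P"
proof -
  have "C \<in> P" "D \<in> P" using assms by (simp_all add: adjacent_cells_def)
  with assms show ?thesis by (simp add: connected_cells_def r_into_rtrancl)
qed

lemma connected_cells_path2:
  assumes "(C, E) \<in> adjacent_cells P" "(E, D) \<in> adjacent_cells P"
  shows "(C, D) \<in> connected_cells P"
proof -
  have "C \<in> P" "D \<in> P" using assms by (simp_all add: adjacent_cells_def)
  moreover have "(C, D) \<in> (adjacent_cells P)\<^sup>*" using assms by (meson r_into_rtrancl rtrancl_trans)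
  ultimately show ?thesis by (simp add: connected_cells_def)
qed

lemma rtrancl_map_rel:
  assumes "(x, y) \<in> R\<^sup>*" "\<And>x y. (x, y) \<in> R \<Longrightarrow> (f x, f y) \<in> S"
  shows "(f x, f y) \<in> S\<^sup>*"
  using assms(1)
proof (induction rule: rtrancl_induct)
  case (step y z)
  then show ?case using assms(2) by (meson rtrancl.rtrancl_into_rtrancl)
qed simp

lemma translate_mem_iff: "t + X \<in> (+) t ` P \<longleftrightarrow> X \<in> (P :: point set)"
  by auto

lemma touching_cells_translate:
  "(t + X, t + Y) \<in> touching_cells ((+) t ` P) \<longleftrightarrow> (X, Y) \<in> touching_cells P"
proof -
  obtain u v i j k l where "t = (u, v)" "X = (i, j)" "Y = (k, l)"
    by (metis surj_pair)
  then show ?thesis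
    using translate_mem_iff[of t X P] translate_mem_iff[of t Y P]
    by (simp add: touching_cells_iff)
qed

text \<open>The two cells meet in one vertex only, and the two other cells at that vertex are
  outside \<open>P\<close>. Translated into the frame, these are joined by a path outside the
  collection, and the parity lemmas apply.\<close>

lemma simple_imp_treelike_aux:
  assumes fr: "frame ((+) t ` P) a b" and sf: "simple_in_frame ((+) t ` P) a b"
    and C: "(i, j) \<in> P" and D: "(k, Suc j) \<in> P" and ik: "i \<le> Suc k" "k \<le> Suc i"
    and nc: "((i, j), (k, Suc j)) \<notin> connected_cells P"
  shows "((i, j), (k, Suc j)) \<notin>
    (touching_cells P - {((i, j), (k, Suc j)), ((k, Suc j), (i, j))})\<^sup>*"
proof
  let ?P = "(+) t ` P"
  let ?R = "\<lambda>P C D. touching_cells P - {(C, D), (D, C)}"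
  assume "((i, j), (k, Suc j)) \<in> (?R P (i, j) (k, Suc j))\<^sup>*"
  then have reach: "(t + (i, j), t + (k, Suc j)) \<in> (?R ?P (t + (i, j)) (t + (k, Suc j)))\<^sup>*"
  proof (rule rtrancl_map_rel)
    fix X Y assume "(X, Y) \<in> ?R P (i, j) (k, Suc j)"
    then show "(t + X, t + Y) \<in> ?R ?P (t + (i, j)) (t + (k, Suc j))"
      by (simp add: touching_cells_translate)
  qed
  obtain u v where t: "t = (u, v)" by fastforce
  have mem: "(u + x, v + y) \<in> ?P \<longleftrightarrow> (x, y) \<in> P" for x y
    using translate_mem_iff[of t "(x, y)"] by (simp add: t)
  have int: "(u + x, v + y) \<in> interval_cells a b"
    if "(x', y') \<in> P" "x \<le> Suc x'" "x' \<le> Suc x" "y \<le> Suc y'" "y' \<le> Suc y" for x y x' y'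
    using frame_interior[OF fr, of "u + x'" "v + y'"] that by (auto simp: mem interval_cells_def)
  \<comment> \<open>Either of these cells, if in \<open>P\<close>, would connect the two given cells
    through common edges.\<close>
  have edge: "(i, Suc j) \<notin> P" "(k, j) \<notin> P"
    using nc connected_cells_path2[of "(i, j)" "(i, Suc j)" P "(k, Suc j)"]
      connected_cells_path2[of "(i, j)" "(k, j)" P "(k, Suc j)"] C D ik
    by (auto simp: adjacent_cells_iff le_Suc_eq)
  have path: "((u + k, v + j), (u + i, v + Suc j)) \<in> (adjacent_cells (- ?P))\<^sup>*"
    using edge int[OF C, of k j] int[OF C, of i "Suc j"] ik
    by (intro complement_connected[OF fr sf]) (auto simp: mem simp del: add_Suc_right)
  have ne: "i \<noteq> k" using edge C by auto
  then consider "k = Suc i" | "i = Suc k" using ik by linarith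
  then show False
  proof cases
    case 1
    show False
      using diagonal_not_reachable[of "u + i" "v + j" ?P "- ?P", OF _ _ _ _ _ _ refl refl]
        reach path C D edge mem[of i j] mem[of k "Suc j"] mem[of k j] mem[of i "Suc j"]
      by (simp add: 1 t)
  next
    case 2
    show False
      using antidiagonal_not_reachable[of "u + k" "v + j" ?P "- ?P", OF _ _ _ _ _ _ refl refl]
        reach path C D edge mem[of i j] mem[of k "Suc j"] mem[of k j] mem[of i "Suc j"]
      by (simp add: 2 t)
  qed
qed

lemma simple_imp_treelike:
  assumes "simple_collection P"
  shows "treelike P"
proof -
  obtain t a b where fr: "frame ((+) t ` P) a b" and sf: "simple_in_frame ((+) t ` P) a b"
    using assms by (auto simp: simple_collection_def)
  have "(C, D) \<notin> (touching_cells P - {(C, D), (D, C)})\<^sup>*"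
    if CD: "(C, D) \<in> touching_cells P" "(C, D) \<notin> connected_cells P" for C D
  proof -
    obtain i j k l where ijkl: "C = (i, j)" "D = (k, l)" by fastforce
    have cs: "(D, C) \<notin> connected_cells P"
      using CD(2) sym_rtrancl[OF sym_adjacent_cells, of P]
      by (auto simp: connected_cells_def dest: symD)
    have *: "(i, j) \<in> P" "(k, l) \<in> P" "i \<le> Suc k" "k \<le> Suc i" "j \<le> Suc l" "l \<le> Suc j"
      using CD(1) by (auto simp: ijkl touching_cells_iff)
    have "j \<noteq> l"
    proof
      assume "j = l"
      with * have "(C, D) \<in> adjacent_cells P" by (auto simp: ijkl adjacent_cells_iff le_Suc_eq)
      with CD(2) show False by (blast dest: connected_cells_adjacent)
    qed
    with * consider "l = Suc j" | "j = Suc l" by linarith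
    then show ?thesis
    proof cases
      case 1
      then show ?thesis
        using simple_imp_treelike_aux[OF fr sf, of i j k] * CD(2) by (simp add: ijkl)
    next
      case 2
      then have nr: "(D, C) \<notin> (touching_cells P - {(C, D), (D, C)})\<^sup>*"
        using simple_imp_treelike_aux[OF fr sf, of k l i] * cs by (simp add: ijkl insert_commute)
      have "sym (touching_cells P - {(C, D), (D, C)})"
        using sym_touching_cells[of P] by (auto simp: sym_def)
      from symD[OF sym_rtrancl[OF this], of C D] nr show ?thesis by argo
    qed
  qed
  then show ?thesis by (auto simp: treelike_def)
qed

section \<open>Splitting a treelike collection into unions of components\<close>

definition edge_closed :: "point set \<Rightarrow> point set \<Rightarrow> bool" where
  "edge_closed P A \<longleftrightarrow> A \<subseteq> P \<and> (\<forall>(C, D) \<in> adjacent_cells P. C \<in> A \<longrightarrow> D \<in> A)"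

lemma edge_closedI:
  assumes "A \<subseteq> P" "\<And>C D. (C, D) \<in> adjacent_cells P \<Longrightarrow> C \<in> A \<Longrightarrow> D \<in> A"
  shows "edge_closed P A"
  using assms unfolding edge_closed_def by blast

lemma edge_closedD:
  "edge_closed P A \<Longrightarrow> (C, D) \<in> adjacent_cells P \<Longrightarrow> C \<in> A \<Longrightarrow> D \<in> A"
  unfolding edge_closed_def by blast

lemma adjacent_cells_mem:
  "(C, D) \<in> adjacent_cells P \<Longrightarrow> C \<in> P" "(C, D) \<in> adjacent_cells P \<Longrightarrow> D \<in> P"
  by (simp_all add: adjacent_cells_def)

lemma edge_closed_Diff:
  assumes "edge_closed P A"
  shows "edge_closed P (P - A)"
proof (rule edge_closedI)
  fix C D assume *: "(C, D) \<in> adjacent_cells P" "C \<in> P - A"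
  then have "(D, C) \<in> adjacent_cells P"
    using symD[OF sym_adjacent_cells] by simp
  with assms * show "D \<in> P - A"
    using edge_closedD[OF assms, of D C] adjacent_cells_mem(2)[OF *(1)] by blast
qed auto

lemma connected_cells_edge_closed:
  assumes "edge_closed P A" "C \<in> A"
  shows "(C, D) \<in> connected_cells A \<longleftrightarrow> (C, D) \<in> connected_cells P"
proof
  assume "(C, D) \<in> connected_cells A"
  moreover have "A \<subseteq> P" using assms by (simp add: edge_closed_def)
  ultimately show "(C, D) \<in> connected_cells P"
    using rtrancl_mono[OF adjacent_cells_mono[of A P]] by (auto simp: connected_cells_def)
next
  assume "(C, D) \<in> connected_cells P"
  then have "(C, D) \<in> (adjacent_cells P)\<^sup>*" by (simp add: connected_cells_def)
  then have "(C, D) \<in> (adjacent_cells A)\<^sup>* \<and> D \<in> A"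
  proof (induction rule: rtrancl_induct)
    case (step Y Z)
    then have "Z \<in> A" using assms(1) by (auto simp: edge_closed_def)
    with step have "(Y, Z) \<in> adjacent_cells A" by (auto simp: adjacent_cells_def)
    with step \<open>Z \<in> A\<close> show ?case by auto
  qed (use assms in simp)
  then show "(C, D) \<in> connected_cells A" using assms(2) by (simp add: connected_cells_def)
qed

lemma treelike_edge_closed:
  assumes "treelike P" "edge_closed P A"
  shows "treelike A"
proof -
  have sub: "touching_cells A \<subseteq> touching_cells P"
    using assms(2) by (auto simp: edge_closed_def touching_cells_def)
  have "(C, D) \<notin> (touching_cells A - {(C, D), (D, C)})\<^sup>*"
    if CD: "(C, D) \<in> touching_cells A" "(C, D) \<notin> connected_cells A" for C D
  proof -
    have "C \<in> A" using CD by (auto simp: touching_cells_def)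
    with CD sub have "(C, D) \<in> touching_cells P - connected_cells P"
      using connected_cells_edge_closed[OF assms(2)] by blast
    with assms(1) have "(C, D) \<notin> (touching_cells P - {(C, D), (D, C)})\<^sup>*"
      by (auto simp: treelike_def)
    moreover have "(touching_cells A - {(C, D), (D, C)})\<^sup>* \<subseteq> (touching_cells P - {(C, D), (D, C)})\<^sup>*"
      using sub by (intro rtrancl_mono) auto
    ultimately show ?thesis by auto
  qed
  then show ?thesis by (auto simp: treelike_def)
qed

text \<open>If distinct components never touch, one component is split off. Otherwise a bridge of
  the contact graph is cut; it is then the only contact between the two sides.\<close>

lemma treelike_split:
  assumes tl: "treelike P" and CD: "C \<in> P" "D \<in> P" "(C, D) \<notin> connected_cells P"
  shows "\<exists>A v. edge_closed P A \<and> A \<noteq> {} \<and> A \<noteq> P \<and> vertices A \<inter> vertices (P - A) \<subseteq> {v}"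
proof (cases "touching_cells P \<subseteq> connected_cells P")
  case True
  define A where "A = connected_cells P `` {C}"
  have closed: "edge_closed P A"
  proof (rule edge_closedI)
    fix X Y assume *: "(X, Y) \<in> adjacent_cells P" "X \<in> A"
    then show "Y \<in> A"
      using adjacent_cells_mem(2)[OF *(1)] unfolding A_def connected_cells_def
      by (auto intro: rtrancl_into_rtrancl)
  qed (auto simp: A_def connected_cells_def)
  have "vertices A \<inter> vertices (P - A) = {}"
  proof -
    have False if "X \<in> A" "Y \<in> P - A" "w \<in> cell_vertices X" "w \<in> cell_vertices Y" for X Y w
    proof -
      have "X \<in> P" using that closed by (auto simp: edge_closed_def)
      then have "(X, Y) \<in> connected_cells P"
        using that True by (auto simp: touching_cells_def)
      then have "Y \<in> A"
        using that(1) by (auto simp: A_def connected_cells_def)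
      with that(2) show False by simp
    qed
    then show ?thesis unfolding vertices_def by blast
  qed
  moreover have "C \<in> A" "D \<notin> A" using CD by (auto simp: A_def connected_cells_def)
  ultimately show ?thesis using closed CD by blast
next
  case False
  then obtain C D where CD: "(C, D) \<in> touching_cells P" "(C, D) \<notin> connected_cells P" by auto
  define R where "R = touching_cells P - {(C, D), (D, C)}"
  \<comment> \<open>The side of \<open>C\<close> after cutting the bridge; \<open>treelike\<close>
    puts \<open>D\<close> on the other side.\<close>
  define A where "A = R\<^sup>* `` {C} \<inter> P"
  have C: "C \<in> A" using CD by (auto simp: A_def touching_cells_def)
  have D: "D \<notin> A" "D \<in> P" using CD tl by (auto simp: A_def R_def treelike_def touching_cells_def)
  have closed: "edge_closed P A"
  proof (rule edge_closedI)
    fix X Y assume XY: "(X, Y) \<in> adjacent_cells P" "X \<in> A"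
    have "(X, Y) \<in> touching_cells P"
      using XY(1) by (cases X; cases Y) (auto simp: adjacent_cells_iff touching_cells_iff)
    moreover have "(X, Y) \<noteq> (C, D)" "(X, Y) \<noteq> (D, C)"
      using XY CD(2) D connected_cells_adjacent[of X Y P] by auto
    ultimately have "(X, Y) \<in> R" by (simp add: R_def)
    then show "Y \<in> A"
      using XY adjacent_cells_mem(2)[OF XY(1)] by (auto simp: A_def intro: rtrancl_into_rtrancl)
  qed (auto simp: A_def)
  have "vertices A \<inter> vertices (P - A) \<subseteq> cell_vertices C \<inter> cell_vertices D"
  proof -
    have "X = C \<and> Y = D" if "X \<in> A" "Y \<in> P - A" "w \<in> cell_vertices X" "w \<in> cell_vertices Y" for X Y w
    proof -
      have "(X, Y) \<in> touching_cells P"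
        using that by (auto simp: A_def touching_cells_def)
      moreover have "(X, Y) \<notin> R"
        using that by (auto simp: A_def intro: rtrancl_into_rtrancl)
      ultimately show ?thesis
        using that D by (auto simp: R_def)
    qed
    then show ?thesis unfolding vertices_def by blast
  qed
  moreover have "\<exists>v. cell_vertices C \<inter> cell_vertices D \<subseteq> {v}"
  proof -
    obtain i j k l where ijkl: "C = (i, j)" "D = (k, l)" by fastforce
    have "\<not> (C, D) \<in> adjacent_cells P" using CD(2) connected_cells_adjacent by blast
    \<comment> \<open>Touching cells without a common edge lie diagonally to each other and so share
      a single vertex.\<close>
    then have "i \<noteq> k" "j \<noteq> l"
      using CD(1) by (auto simp: ijkl adjacent_cells_iff touching_cells_iff le_Suc_eq)
    then show ?thesis
      by (intro exI[of _ "(max i k, max j l)"]) (auto simp: ijkl cell_vertices_eq)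
  qed
  ultimately show ?thesis using closed C D by blast
qed

text \<open>Induction on the collection: as long as there are two components, it splits into smaller
  treelike collections, whose components are components of \<open>P\<close>, and these are glued.
  Otherwise \<open>P\<close> is empty or a single component.\<close>

lemma saturated_treelike:
  assumes "finite P" "treelike P"
    and "\<And>C. C \<in> P \<Longrightarrow> row_convex (connected_cells P `` {C}) \<or> column_convex (connected_cells P `` {C})"
  shows "saturated P"
  using assms
proof (induction P rule: finite_psubset_induct)
  case (psubset P)
  show ?case
  proof (cases "\<exists>C\<in>P. \<exists>D\<in>P. (C, D) \<notin> connected_cells P")
    case True
    then obtain A v where A: "edge_closed P A" "A \<noteq> {}" "A \<noteq> P"
      and v: "vertices A \<inter> vertices (P - A) \<subseteq> {v}"
      using treelike_split[OF psubset.prems(1)] by blast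
    have sat: "saturated B" if B: "edge_closed P B" "B \<noteq> P" for B
    proof (rule psubset.IH)
      show "B \<subset> P" using B by (auto simp: edge_closed_def)
      show "treelike B" by (rule treelike_edge_closed[OF psubset.prems(1) B(1)])
      fix C assume C: "C \<in> B"
      then have "connected_cells B `` {C} = connected_cells P `` {C}"
        using connected_cells_edge_closed[OF B(1) C] by auto
      moreover have "C \<in> P" using C B by (auto simp: edge_closed_def)
      ultimately show "row_convex (connected_cells B `` {C}) \<or> column_convex (connected_cells B `` {C})"
        using psubset.prems(2) by simp
    qed
    have "A \<subseteq> P" using A by (simp add: edge_closed_def)
    with A have "P - A \<noteq> P" by auto
    then have "saturated (A \<union> (P - A))"
      using A sat edge_closed_Diff by (intro saturated_glue[OF _ _ v]) auto
    with \<open>A \<subseteq> P\<close> show ?thesis by (simp add: Un_absorb1)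
  next
    case False
    have "row_convex P \<or> column_convex P"
    proof (cases "P = {}")
      case True
      then show ?thesis by (simp add: row_convex_def)
    next
      case nonempty: False
      then obtain C where "C \<in> P" by auto
      moreover from this have "connected_cells P `` {C} = P"
        using False by (auto simp: connected_cells_def)
      ultimately show ?thesis using psubset.prems(2) by metis
    qed
    then show ?thesis
      using saturated_row_convex saturated_column_convex psubset.hyps by blast
  qed
qed

subsection \<open>The inner minor ideal as a kernel\<close>

lemma poly_mapping_eq_sum: "p = (\<Sum>m\<in>Poly_Mapping.keys p. Poly_Mapping.single m (Poly_Mapping.lookup p m))"
  by (rule poly_mapping_eqI)
     (simp add: lookup_sum lookup_single when_def in_keys_iff)

text \<open>The linear extension of a map of exponents; for additive \<open>w\<close> it is the
  homomorphism of monoid algebras induced by \<open>w\<close>.\<close>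

definition map_monomials :: "('m \<Rightarrow> 'n) \<Rightarrow> ('m \<Rightarrow>\<^sub>0 'k) \<Rightarrow> ('n \<Rightarrow>\<^sub>0 'k :: comm_monoid_add)" where
  "map_monomials w p = (\<Sum>m\<in>Poly_Mapping.keys p. Poly_Mapping.single (w m) (Poly_Mapping.lookup p m))"

lemma map_monomials_superset:
  assumes "finite S" "Poly_Mapping.keys p \<subseteq> S"
  shows "map_monomials w p = (\<Sum>m\<in>S. Poly_Mapping.single (w m) (Poly_Mapping.lookup p m))"
  unfolding map_monomials_def
  by (rule sum.mono_neutral_left) (use assms in \<open>auto simp: in_keys_iff\<close>)

lemma map_monomials_add: "map_monomials w (p + q) = map_monomials w p + map_monomials w q"
proof -
  let ?S = "Poly_Mapping.keys p \<union> Poly_Mapping.keys q"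
  have "map_monomials w (p + q) = (\<Sum>m\<in>?S. Poly_Mapping.single (w m) (Poly_Mapping.lookup (p + q) m))"
    by (rule map_monomials_superset) (simp_all add: keys_add)
  also have "\<dots> = map_monomials w p + map_monomials w q"
    by (simp add: map_monomials_superset[of ?S p] map_monomials_superset[of ?S q] lookup_add single_add sum.distrib)
  finally show ?thesis .
qed

lemma map_monomials_zero [simp]: "map_monomials w 0 = 0"
  by (simp add: map_monomials_def)

lemma map_monomials_single [simp]: "map_monomials w (Poly_Mapping.single m c) = Poly_Mapping.single (w m) c"
  by (subst map_monomials_superset[of "{m}"]) auto

lemma map_monomials_sum: "map_monomials w (\<Sum>x\<in>S. f x) = (\<Sum>x\<in>S. map_monomials w (f x))"
  by (induction S rule: infinite_finite_induct) (simp_all add: map_monomials_add)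

lemma map_monomials_mult:
  fixes p q :: "'m::comm_monoid_add \<Rightarrow>\<^sub>0 'k::comm_semiring_0"
  assumes w: "\<And>a b. w (a + b) = (w a + w b :: 'n :: comm_monoid_add)"
  shows "map_monomials w (p * q) = map_monomials w p * map_monomials w q"
proof -
  let ?P = "Poly_Mapping.keys p" and ?Q = "Poly_Mapping.keys q"
  have "p * q = (\<Sum>a\<in>?P. \<Sum>b\<in>?Q. Poly_Mapping.single (a + b)
      (Poly_Mapping.lookup p a * Poly_Mapping.lookup q b))"
    by (subst poly_mapping_eq_sum[of p], subst poly_mapping_eq_sum[of q])
       (simp add: sum_product mult_single)
  then have "map_monomials w (p * q) = (\<Sum>a\<in>?P. \<Sum>b\<in>?Q. Poly_Mapping.single (w a + w b)
      (Poly_Mapping.lookup p a * Poly_Mapping.lookup q b))"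
    by (simp add: map_monomials_sum w)
  also have "\<dots> = map_monomials w p * map_monomials w q"
    by (simp add: map_monomials_def sum_product mult_single)
  finally show ?thesis .
qed

lemma map_monomials_uminus: "map_monomials w (- p) = - map_monomials w (p :: _ \<Rightarrow>\<^sub>0 'k::ab_group_add)"
  using map_monomials_add[of w p "- p"] by (simp add: eq_neg_iff_add_eq_0 add.commute)

text \<open>Coefficients add up over the fibres of \<open>w\<close>, so a monomial that is alone in
  its fibre survives in the image.\<close>

lemma lookup_map_monomials:
  "Poly_Mapping.lookup (map_monomials w p) n = (\<Sum>m\<in>{m \<in> Poly_Mapping.keys p. w m = n}. Poly_Mapping.lookup p m)"
  unfolding map_monomials_def lookup_sum lookup_single when_def
  by (subst sum.inter_filter[symmetric]) auto

section \<open>Monomials as multisets and their toric weights\<close>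

definition mset_monomial :: "point multiset \<Rightarrow> point \<Rightarrow>\<^sub>0 nat" where
  "mset_monomial U = (\<Sum>p\<in>#U. Poly_Mapping.single p 1)"

lemma mset_monomial_simps [simp]: "mset_monomial {#} = 0" "mset_monomial (add_mset p U) = Poly_Mapping.single p 1 + mset_monomial U"
  by (simp_all add: mset_monomial_def)

lemma lookup_mset_monomial: "Poly_Mapping.lookup (mset_monomial U) p = count U p"
  by (induction U) (auto simp: lookup_add lookup_single when_def)

lemma keys_mset_monomial: "Poly_Mapping.keys (mset_monomial U) = set_mset U"
  by (auto simp: in_keys_iff lookup_mset_monomial)

lemma surj_mset_monomial: "\<exists>U. m = mset_monomial U"
proof -
  have "finite {p. 0 < Poly_Mapping.lookup m p}"
    using finite_keys[of m] by (simp add: keys.rep_eq)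
  then have "m = mset_monomial (Abs_multiset (Poly_Mapping.lookup m))"
    by (intro poly_mapping_eqI) (simp add: lookup_mset_monomial Abs_multiset_inverse)
  then show ?thesis ..
qed

text \<open>
  The toric parametrization: \<open>x\<^sub>p\<close> is sent to the product of the variables \<open>y\<^sub>c\<close> with \<open>c \<ge> p\<close> in \<open>S\<close>.
  The points \<open>c\<close> are encoded as natural numbers because exponent vectors over a linearly ordered
  index type are what the library uses to show that the polynomials form an integral domain.
\<close>

definition weight :: "point set \<Rightarrow> (point \<Rightarrow>\<^sub>0 nat) \<Rightarrow> (nat \<Rightarrow>\<^sub>0 nat)" where
  "weight S m = (\<Sum>c\<in>S. Poly_Mapping.single (prod_encode c) (\<Sum>p\<le>c. Poly_Mapping.lookup m p))"

lemma weight_add: "weight S (m + n) = weight S m + weight S n"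
  by (simp add: weight_def lookup_add sum.distrib single_add)

lemma weight_zero: "weight S 0 = 0"
  by (simp add: weight_def)

lemma finite_atMost_point: "finite {..c :: point}"
proof -
  have "{..c} \<subseteq> {..fst c} \<times> {..snd c}" by (auto simp: less_eq_prod_def)
  then show ?thesis by (rule finite_subset) simp
qed

lemma sum_lookup_mset_monomial: "int (\<Sum>p\<le>c. Poly_Mapping.lookup (mset_monomial U) p) = (\<Sum>p\<in>#U. of_bool (p \<le> c))"
proof (induction U)
  case (add x U)
  have "(\<Sum>p\<le>c. Poly_Mapping.lookup (Poly_Mapping.single x 1) p) = (of_bool (x \<le> c) :: nat)"
    by (simp add: lookup_single when_def finite_atMost_point)
  with add show ?case by (simp add: lookup_add sum.distrib del: of_nat_sum)
qed simp

text \<open>The exponent of the variable belonging to \<open>c\<close> is the number of points of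
  the multiset below \<open>c\<close>.\<close>

lemma weight_mset_monomial_eq_iff:
  assumes "finite S"
  shows "weight S (mset_monomial U) = weight S (mset_monomial V) \<longleftrightarrow>
    (\<forall>c\<in>S. (\<Sum>p\<in>#U. of_bool (p \<le> c) :: int) = (\<Sum>p\<in>#V. of_bool (p \<le> c)))"
proof -
  have lookup: "Poly_Mapping.lookup (weight S m) (prod_encode c) = (\<Sum>p\<le>c. Poly_Mapping.lookup m p)"
    if "c \<in> S" for m c
    using that assms by (simp add: weight_def lookup_sum lookup_single when_def prod_encode_eq)
  have "weight S (mset_monomial U) = weight S (mset_monomial V) \<longleftrightarrow>
    (\<forall>c\<in>S. (\<Sum>p\<le>c. Poly_Mapping.lookup (mset_monomial U) p) = (\<Sum>p\<le>c. Poly_Mapping.lookup (mset_monomial V) p))"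
    (is "?L \<longleftrightarrow> ?R")
  proof
    assume ?L then show ?R using lookup by metis
  next
    assume ?R then show ?L unfolding weight_def by (intro sum.cong) auto
  qed
  then show ?thesis
    unfolding sum_lookup_mset_monomial[symmetric] of_nat_eq_iff .
qed

text \<open>The mixed second difference of this indicator is nonzero only on the cell with lower
  left corner \<open>c\<close>.\<close>

lemma potential_le:
  assumes "c \<notin> P"
  shows "potential P (\<lambda>p. of_bool (p \<le> c))"
proof (rule potentialI)
  fix i j assume "(i, j) \<in> P"
  with assms have "c \<noteq> (i, j)" by auto
  then show "(of_bool ((i, j) \<le> c) + of_bool ((Suc i, Suc j) \<le> c) :: int) =
      of_bool ((Suc i, j) \<le> c) + of_bool ((i, Suc j) \<le> c)"
    by (cases c) auto
qed

text \<open>Moebius inversion for a product of two chains; the boundary terms vanish by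
  \<open>zero\<close>.\<close>

lemma telescope_2d:
  fixes g :: "nat \<Rightarrow> nat \<Rightarrow> int"
  assumes "i \<le> M" "j \<le> M" and zero: "\<And>k. g k M = 0" "\<And>l. g M l = 0"
  shows "(\<Sum>k=i..<M. \<Sum>l=j..<M. g k l - g (Suc k) l - g k (Suc l) + g (Suc k) (Suc l)) = g i j"
proof -
  have inner: "(\<Sum>l=j..<M. g k l - g (Suc k) l - g k (Suc l) + g (Suc k) (Suc l)) = g k j - g (Suc k) j" for k
  proof -
    have "(\<Sum>l=j..<M. g k l - g (Suc k) l - g k (Suc l) + g (Suc k) (Suc l)) =
        - (\<Sum>l=j..<M. (g k (Suc l) - g (Suc k) (Suc l)) - (g k l - g (Suc k) l))"
      by (simp add: sum_negf[symmetric] algebra_simps)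
    also have "\<dots> = g k j - g (Suc k) j"
      using sum_Suc_diff'[OF assms(2), of "\<lambda>l. g k l - g (Suc k) l"] zero by simp
    finally show ?thesis .
  qed
  then have "(\<Sum>k=i..<M. \<Sum>l=j..<M. g k l - g (Suc k) l - g k (Suc l) + g (Suc k) (Suc l)) =
      - (\<Sum>k=i..<M. g (Suc k) j - g k j)"
    by (simp only: inner) (simp add: sum_negf[symmetric])
  also have "\<dots> = g i j"
    using sum_Suc_diff'[OF assms(1), of "\<lambda>k. g k j"] zero by simp
  finally show ?thesis .
qed

lemma sum_mset_sum_swap:
  "(\<Sum>p\<in>#U. \<Sum>c\<in>S. h p c) = (\<Sum>c\<in>S. \<Sum>p\<in>#U. (h p c :: int))"
  by (induction U) (simp_all add: sum.distrib)

text \<open>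
  A potential for \<open>P\<close> agrees on the box with an integer combination of the potentials
  \<open>\<lambda>p. of_bool (p \<le> c)\<close>, where \<open>c\<close> runs through the points of the box outside \<open>P\<close>
  (Moebius inversion for the product order).
\<close>
lemma potential_equiv_if_weight_eq:
  assumes P: "vertices P \<subseteq> {..<M} \<times> {..<M}"
    and UV: "set_mset U \<subseteq> {..<M} \<times> {..<M}" "set_mset V \<subseteq> {..<M} \<times> {..<M}"
    and eq: "weight ({..<M} \<times> {..<M} - P) (mset_monomial U) = weight ({..<M} \<times> {..<M} - P) (mset_monomial V)"
  shows "potential_equiv P U V"
  unfolding potential_equiv_def
proof (intro allI impI)
  fix f assume f: "potential P f"
  let ?B = "{..<M} \<times> {..<M}"
  \<comment> \<open>Cutting \<open>f\<close> off to 0 outside the box removes the boundary terms of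
    the telescoping sum. Cells of \<open>P\<close> have all vertices inside the box, so the cut-off
    leaves their mixed differences unchanged.\<close>
  define g where "g k l = (if k < M \<and> l < M then f (k, l) else 0)" for k l
  define h where "h = (\<lambda>(k, l). g k l - g (Suc k) l - g k (Suc l) + g (Suc k) (Suc l))"
  have h0: "h c = 0" if "c \<in> P" for c
  proof -
    obtain k l where c: "c = (k, l)" by fastforce
    have "Suc k < M" "Suc l < M"
      using vertices_cell(4)[of k l P] that P by (auto simp: c)
    then show ?thesis
      using potentialD[OF f, of k l] that by (simp add: h_def g_def c)
  qed
  have f_eq: "f p = (\<Sum>c\<in>?B - P. of_bool (p \<le> c) * h c)" if p: "p \<in> ?B" for p
  proof -
    obtain i j where ij: "p = (i, j)" by fastforce
    have "f p = (\<Sum>k=i..<M. \<Sum>l=j..<M. h (k, l))"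
      using telescope_2d[of i M j g] p by (simp add: h_def g_def ij)
    also have "\<dots> = (\<Sum>c\<in>{i..<M} \<times> {j..<M}. h c)"
      by (simp add: sum.cartesian_product)
    also have "{i..<M} \<times> {j..<M} = {c \<in> ?B. p \<le> c}"
      by (auto simp: ij)
    also have "(\<Sum>c\<in>{c \<in> ?B. p \<le> c}. h c) = (\<Sum>c\<in>?B. of_bool (p \<le> c) * h c)"
      by (rule sum.mono_neutral_cong_left) auto
    also have "\<dots> = (\<Sum>c\<in>?B - P. of_bool (p \<le> c) * h c)"
      by (rule sum.mono_neutral_right) (auto simp: h0)
    finally show ?thesis .
  qed
  have sum_eq: "(\<Sum>p\<in>#W. f p) = (\<Sum>c\<in>?B - P. (\<Sum>p\<in>#W. of_bool (p \<le> c)) * h c)"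
    if "set_mset W \<subseteq> ?B" for W
  proof -
    have "(\<Sum>p\<in>#W. f p) = (\<Sum>p\<in>#W. \<Sum>c\<in>?B - P. of_bool (p \<le> c) * h c)"
      using that f_eq by (intro arg_cong[where f = sum_mset] image_mset_cong) auto
    then show ?thesis
      by (simp only: sum_mset_sum_swap sum_mset_distrib_right)
  qed
  have "\<forall>c\<in>?B - P. (\<Sum>p\<in>#U. of_bool (p \<le> c) :: int) = (\<Sum>p\<in>#V. of_bool (p \<le> c))"
    using eq weight_mset_monomial_eq_iff[of "?B - P"] by simp
  then show "(\<Sum>p\<in>#U. f p) = (\<Sum>p\<in>#V. f p)"
    unfolding sum_eq[OF UV(1)] sum_eq[OF UV(2)] by (intro sum.cong) auto
qed

section \<open>The polynomial ring and membership in the inner minor ideal\<close>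

lemma poly_ring_simps [simp]:
  "monoid.mult (poly_ring V) = (*)" "one (poly_ring V) = 1" "zero (poly_ring V) = 0"
  "add (poly_ring V) = (+)"
  "p \<in> carrier (poly_ring V) \<longleftrightarrow> (\<forall>m \<in> Poly_Mapping.keys p. Poly_Mapping.keys m \<subseteq> V)"
  by (simp_all add: poly_ring_def)

lemma poly_ring_add_closed:
  assumes "p \<in> carrier (poly_ring V)" "q \<in> carrier (poly_ring V)"
  shows "p + q \<in> carrier (poly_ring V)"
  using assms keys_add[of p q] by (simp del: subset_iff) blast

lemma poly_ring_uminus_closed:
  "p \<in> carrier (poly_ring V) \<Longrightarrow> - p \<in> carrier (poly_ring V)"
  by simp

lemma poly_ring_mult_closed:
  assumes "p \<in> carrier (poly_ring V)" "q \<in> carrier (poly_ring V)"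
  shows "p * q \<in> carrier (poly_ring V)"
  unfolding poly_ring_simps
proof
  fix m assume "m \<in> Poly_Mapping.keys (p * q)"
  then obtain a b where "m = a + b" "a \<in> Poly_Mapping.keys p" "b \<in> Poly_Mapping.keys q"
    using keys_mult[of p q] by auto
  then show "Poly_Mapping.keys m \<subseteq> V"
    using assms keys_add[of a b] unfolding poly_ring_simps by blast
qed

lemma cring_poly_ring: "cring (poly_ring V :: 'k::field point_poly ring)"
proof (rule cringI)
  show "abelian_group (poly_ring V :: 'k point_poly ring)"
  proof (rule abelian_groupI)
    fix p :: "'k point_poly" assume "p \<in> carrier (poly_ring V)"
    then show "\<exists>q\<in>carrier (poly_ring V). q \<oplus>\<^bsub>poly_ring V\<^esub> p = \<zero>\<^bsub>poly_ring V\<^esub>"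
      by (intro bexI[of _ "- p"] poly_ring_uminus_closed) simp_all
  qed (use poly_ring_add_closed in \<open>simp_all add: ac_simps\<close>)
  show "Group.comm_monoid (poly_ring V :: 'k point_poly ring)"
    by (rule comm_monoidI) (use poly_ring_mult_closed in \<open>simp_all add: ac_simps\<close>)
qed (simp add: algebra_simps)

lemma inner_interval_vertices:
  assumes "inner_interval P (i, j) (k, l)"
  shows "(i, j) \<in> vertices P" "(k, l) \<in> vertices P" "(k, j) \<in> vertices P" "(i, l) \<in> vertices P"
proof -
  obtain k' l' where kl: "k = Suc k'" "l = Suc l'" "i \<le> k'" "j \<le> l'"
    using assms unfolding inner_interval_iff by (metis less_iff_Suc_add le_add1 add_Suc_right)
  with assms have "(i, j) \<in> P" "(k', l') \<in> P" "(k', j) \<in> P" "(i, l') \<in> P"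
    unfolding inner_interval_iff by auto
  then show "(i, j) \<in> vertices P" "(k, l) \<in> vertices P" "(k, j) \<in> vertices P" "(i, l) \<in> vertices P"
    unfolding kl by (blast intro: vertices_cell)+
qed

definition monomial_poly :: "point multiset \<Rightarrow> 'k::field point_poly" where
  "monomial_poly U = Poly_Mapping.single (mset_monomial U) 1"

lemma monomial_poly_carrier:
  "set_mset U \<subseteq> V \<Longrightarrow> monomial_poly U \<in> carrier (poly_ring V)"
  by (simp add: monomial_poly_def keys_mset_monomial)

lemma minor_eq:
  "minor (i, j) (k, l) = monomial_poly {#(i, j), (k, l)#} - monomial_poly {#(k, j), (i, l)#}"
  by (simp add: minor_def monomial_poly_def var_def mult_single)

lemma monomial_poly_mult: "monomial_poly U * monomial_poly V = monomial_poly (U + V)"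
  by (simp add: monomial_poly_def mult_single mset_monomial_def)

lemma inner_minors_carrier:
  "(inner_minors P :: 'k::field point_poly set) \<subseteq> carrier (poly_ring (vertices P))"
proof
  fix p :: "'k point_poly" assume "p \<in> inner_minors P"
  then obtain i j k l where I: "inner_interval P (i, j) (k, l)" and p: "p = minor (i, j) (k, l)"
    by (auto simp: inner_minors_def)
  have "p = monomial_poly {#(i, j), (k, l)#} + - monomial_poly {#(k, j), (i, l)#}"
    by (simp add: p minor_eq)
  also have "\<dots> \<in> carrier (poly_ring (vertices P))"
    using inner_interval_vertices[OF I]
    by (intro poly_ring_add_closed poly_ring_uminus_closed monomial_poly_carrier) auto
  finally show "p \<in> carrier (poly_ring (vertices P))" .
qed

lemma ideal_inner_minor_ideal:
  "ideal (inner_minor_ideal P) (poly_ring (vertices P))"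
  unfolding inner_minor_ideal_def
  by (rule ring.genideal_ideal[OF cring.axioms(1)[OF cring_poly_ring] inner_minors_carrier])

lemma inner_minor_ideal_add:
  "p \<in> inner_minor_ideal P \<Longrightarrow> q \<in> inner_minor_ideal P \<Longrightarrow> p + q \<in> inner_minor_ideal P"
  using additive_subgroup.a_closed[OF ideal.axioms(1)[OF ideal_inner_minor_ideal]] by fastforce

lemma inner_minor_ideal_zero: "0 \<in> inner_minor_ideal P"
  using additive_subgroup.zero_closed[OF ideal.axioms(1)[OF ideal_inner_minor_ideal]] by fastforce

lemma inner_minor_ideal_mult:
  "p \<in> inner_minor_ideal P \<Longrightarrow> q \<in> carrier (poly_ring (vertices P)) \<Longrightarrow> q * p \<in> inner_minor_ideal P"
  using ideal.I_l_closed[OF ideal_inner_minor_ideal] by fastforce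

lemma inner_minor_ideal_uminus:
  assumes "p \<in> inner_minor_ideal P"
  shows "- p \<in> inner_minor_ideal P"
proof -
  have "- 1 \<in> carrier (poly_ring (vertices P))"
    by (rule poly_ring_uminus_closed) simp
  from inner_minor_ideal_mult[OF assms this] show ?thesis by simp
qed

lemma inner_minor_ideal_minor:
  "inner_interval P a b \<Longrightarrow> minor a b \<in> inner_minor_ideal P"
  using ring.genideal_self[OF cring.axioms(1)[OF cring_poly_ring] inner_minors_carrier]
  unfolding inner_minor_ideal_def inner_minors_def by blast

text \<open>The claim about vertices is carried through the induction because transitivity passes
  through an intermediate monomial, which has to lie in the ring.\<close>

lemma minor_equiv_imp_ideal:
  assumes "minor_equiv P U V"
  shows "(set_mset U \<subseteq> vertices P \<longleftrightarrow> set_mset V \<subseteq> vertices P) \<and>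
    (set_mset U \<subseteq> vertices P \<longrightarrow> monomial_poly U - monomial_poly V \<in> (inner_minor_ideal P :: 'k::field point_poly set))"
  using assms
proof (induction rule: minor_equiv.induct)
  case (minor_refl U)
  show ?case by (simp add: inner_minor_ideal_zero)
next
  case (minor_sym U V)
  have "- (monomial_poly U - monomial_poly V) \<in> (inner_minor_ideal P :: 'k point_poly set)" if "set_mset U \<subseteq> vertices P"
    using that minor_sym.IH by (intro inner_minor_ideal_uminus) simp
  with minor_sym.IH show ?case by simp
next
  case (minor_trans U V W)
  have "(monomial_poly U - monomial_poly V) + (monomial_poly V - monomial_poly W) \<in>
      (inner_minor_ideal P :: 'k point_poly set)"
    if "set_mset U \<subseteq> vertices P"
    using that minor_trans.IH by (intro inner_minor_ideal_add) simp_all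
  with minor_trans.IH show ?case by simp
next
  case (minor_swap i j k l U)
  have "monomial_poly (add_mset (i, j) (add_mset (k, l) U)) - monomial_poly (add_mset (k, j) (add_mset (i, l) U)) =
      (monomial_poly U * minor (i, j) (k, l) :: 'k point_poly)"
    by (simp add: minor_eq right_diff_distrib monomial_poly_mult)
  moreover have "monomial_poly U * minor (i, j) (k, l) \<in> (inner_minor_ideal P :: 'k point_poly set)" if "set_mset U \<subseteq> vertices P"
    using minor_swap that
    by (intro inner_minor_ideal_mult inner_minor_ideal_minor monomial_poly_carrier)
  ultimately show ?case
    using inner_interval_vertices[OF minor_swap] by simp
qed

text \<open>A nonzero polynomial in the kernel has, for each of its monomials, another one of the
  same weight. Saturation puts the difference of the two into the ideal, and subtracting a multiple
  of it shortens the polynomial.\<close>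

lemma inner_minor_ideal_eq_kernel:
  fixes P :: "point set"
  defines "I \<equiv> inner_minor_ideal P :: 'k::field point_poly set"
  assumes fin: "finite P" and sat: "saturated P" and M: "vertices P \<subseteq> {..<M} \<times> {..<M}"
  defines "w \<equiv> weight ({..<M} \<times> {..<M} - P)"
  shows "I = {p \<in> carrier (poly_ring (vertices P)). map_monomials w p = 0}" (is "_ = ?K")
proof
  let ?R = "poly_ring (vertices P) :: 'k point_poly ring"
  interpret R: cring ?R by (rule cring_poly_ring)
  have wadd: "w (a + b) = w a + w b" for a b by (simp add: w_def weight_add)
  have "ideal ?K ?R"
  proof (rule idealI)
    show "subgroup ?K (add_monoid ?R)"
    proof (rule group.subgroupI[OF R.add.is_group])
      show "?K \<noteq> {}" by (auto intro!: exI[of _ 0])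
      fix p q assume p: "p \<in> ?K" and q: "q \<in> ?K"
      have "inv\<^bsub>add_monoid ?R\<^esub> p = - p"
        using p poly_ring_uminus_closed[of p "vertices P"] R.minus_equality[of "- p" p]
        by (simp add: a_inv_def)
      then show "inv\<^bsub>add_monoid ?R\<^esub> p \<in> ?K"
        using p by (simp add: map_monomials_uminus)
      show "p \<otimes>\<^bsub>add_monoid ?R\<^esub> q \<in> ?K"
        using p q poly_ring_add_closed[of p "vertices P" q] by (simp add: map_monomials_add)
    qed auto
  next
    fix p q assume "p \<in> ?K" "q \<in> carrier ?R"
    then show "q \<otimes>\<^bsub>?R\<^esub> p \<in> ?K" "p \<otimes>\<^bsub>?R\<^esub> q \<in> ?K"
      using poly_ring_mult_closed[of q "vertices P" p] poly_ring_mult_closed[of p "vertices P" q]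
      by (simp_all add: map_monomials_mult[OF wadd] del: poly_ring_simps(5))
  qed (rule R.ring_axioms)
  moreover have "inner_minors P \<subseteq> ?K"
  proof
    fix p :: "'k point_poly" assume p: "p \<in> inner_minors P"
    then obtain i j k l where ij: "inner_interval P (i, j) (k, l)" and p_eq: "p = minor (i, j) (k, l)"
      by (auto simp: inner_minors_def)
    \<comment> \<open>The weight uses only points \<open>c\<close> outside \<open>P\<close>, for
      which counting the points below \<open>c\<close> is a potential.\<close>
    have "w (mset_monomial {#(i, j), (k, l)#}) = w (mset_monomial {#(k, j), (i, l)#})"
      unfolding w_def using potential_corners[OF potential_le ij]
      by (subst weight_mset_monomial_eq_iff) auto
    then have "map_monomials w p = 0"
      using map_monomials_add[of w "monomial_poly {#(i, j), (k, l)#}" "- monomial_poly {#(k, j), (i, l)#}"]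
      by (simp add: p_eq minor_eq map_monomials_uminus monomial_poly_def)
    with p show "p \<in> ?K" using inner_minors_carrier by blast
  qed
  ultimately show "I \<subseteq> ?K"
    unfolding I_def inner_minor_ideal_def by (rule R.genideal_minimal)
  have "p \<in> I" if "p \<in> ?K" for p
    using that
  proof (induction "card (Poly_Mapping.keys p)" arbitrary: p rule: less_induct)
    case less
    show ?case
    proof (cases "p = 0")
      case True
      then show ?thesis by (simp add: I_def inner_minor_ideal_zero)
    next
      case False
      then obtain m where m: "m \<in> Poly_Mapping.keys p" by (meson all_not_in_conv keys_eq_empty)
      define c where "c = Poly_Mapping.lookup p m"
      have "c \<noteq> 0" using m by (simp add: c_def in_keys_iff)
      have "\<exists>m'\<in>Poly_Mapping.keys p. m' \<noteq> m \<and> w m' = w m"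
      proof (rule ccontr)
        assume "\<not> ?thesis"
        with m have "{m' \<in> Poly_Mapping.keys p. w m' = w m} = {m}" by auto
        with lookup_map_monomials[of w p "w m"] have "Poly_Mapping.lookup (map_monomials w p) (w m) = c"
          by (simp add: c_def)
        with less.prems \<open>c \<noteq> 0\<close> show False by simp
      qed
      then obtain m' where m': "m' \<in> Poly_Mapping.keys p" "m' \<noteq> m" "w m' = w m" by blast
      obtain U V where U: "m = mset_monomial U" and V: "m' = mset_monomial V" using surj_mset_monomial by metis
      have UV: "set_mset U \<subseteq> vertices P" "set_mset V \<subseteq> vertices P"
        using less.prems m m'(1) unfolding mem_Collect_eq poly_ring_simps U V keys_mset_monomial[symmetric]
        by blast+
      have "potential_equiv P U V"
        using m'(3) UV M unfolding U V w_def
        by (intro potential_equiv_if_weight_eq[of P M]) auto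
      with sat have "minor_equiv P U V" by (simp add: saturated_def)
      from minor_equiv_imp_ideal[OF this] UV
      have "monomial_poly U - monomial_poly V \<in> I" by (simp add: I_def)
      then have bin: "Poly_Mapping.single 0 c * (monomial_poly U - monomial_poly V) \<in> I"
        unfolding I_def by (rule inner_minor_ideal_mult) simp
      define q where "q = p - Poly_Mapping.single 0 c * (monomial_poly U - monomial_poly V)"
      have q_eq: "q = p + (- Poly_Mapping.single m c + Poly_Mapping.single m' c)"
        by (simp add: q_def monomial_poly_def right_diff_distrib mult_single U V)
      \<comment> \<open>The monomial \<open>m\<close> cancels, and no new one appears because
        \<open>m'\<close> already occurs in \<open>p\<close>.\<close>
      have keys_q: "Poly_Mapping.keys q \<subseteq> Poly_Mapping.keys p - {m}"
      proof
        fix n assume n: "n \<in> Poly_Mapping.keys q"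
        have "Poly_Mapping.lookup q n = Poly_Mapping.lookup p n - (c when m = n) + (c when m' = n)"
          by (simp add: q_eq lookup_add lookup_single lookup_minus)
        with n m' show "n \<in> Poly_Mapping.keys p - {m}"
          by (auto simp: in_keys_iff c_def when_def split: if_splits)
      qed
      have "map_monomials w q = 0"
        using less.prems m'(3) unfolding q_eq map_monomials_add map_monomials_uminus map_monomials_single by simp
      then have "q \<in> ?K"
        using less.prems keys_q by auto
      moreover have "card (Poly_Mapping.keys q) < card (Poly_Mapping.keys p)"
        using keys_q m by (intro psubset_card_mono) auto
      ultimately have "q \<in> I" by (rule less.hyps[rotated])
      with bin have "q + Poly_Mapping.single 0 c * (monomial_poly U - monomial_poly V) \<in> I"
        unfolding I_def by (intro inner_minor_ideal_add)
      then show ?thesis by (simp add: q_def)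
    qed
  qed
  then show "?K \<subseteq> I" by blast
qed

lemma finite_vertices: "finite P \<Longrightarrow> finite (vertices P)"
  by (auto simp: vertices_def cell_vertices_eq)

text \<open>The ideal is the kernel of a homomorphism into an integral domain, for any box
  containing all vertices.\<close>

lemma primeideal_if_saturated:
  fixes P :: "point set"
  assumes fin: "finite P" and sat: "saturated P"
  shows "primeideal (inner_minor_ideal P :: 'k::field point_poly set) (poly_ring (vertices P))"
proof -
  have "finite (fst ` vertices P \<union> snd ` vertices P)"
    using finite_vertices[OF fin] by simp
  then obtain M where "\<forall>x\<in>fst ` vertices P \<union> snd ` vertices P. x < M"
    by (meson finite_nat_set_iff_bounded)
  then have M: "vertices P \<subseteq> {..<M} \<times> {..<M}" by force
  define w where "w = weight ({..<M} \<times> {..<M} - P)"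
  note I_eq = inner_minor_ideal_eq_kernel[OF fin sat M, folded w_def, where 'k = 'k]
  have wadd: "w (a + b) = w a + w b" for a b by (simp add: w_def weight_add)
  show ?thesis
  proof (rule primeidealI[OF ideal_inner_minor_ideal cring_poly_ring])
    have "map_monomials w (1 :: 'k point_poly) = 1"
      by (simp add: w_def weight_zero flip: single_one)
    then have "(1 :: 'k point_poly) \<notin> inner_minor_ideal P"
      unfolding I_eq by simp
    moreover have "(1 :: 'k point_poly) \<in> carrier (poly_ring (vertices P))"
      by simp
    ultimately show "carrier (poly_ring (vertices P)) \<noteq> (inner_minor_ideal P :: 'k point_poly set)"
      by blast
  next
    fix p q :: "'k point_poly"
    assume "p \<in> carrier (poly_ring (vertices P))" "q \<in> carrier (poly_ring (vertices P))"
      and "p \<otimes>\<^bsub>poly_ring (vertices P)\<^esub> q \<in> inner_minor_ideal P"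
    then show "p \<in> inner_minor_ideal P \<or> q \<in> inner_minor_ideal P"
      \<comment> \<open>The images multiply to 0, and polynomials with exponent vectors indexed by
        \<open>nat\<close> have no zero divisors.\<close>
      unfolding I_eq by (simp add: map_monomials_mult[OF wadd])
  qed
qed

theorem theorem3p10:
  fixes P :: "(nat \<times> nat) set"
  assumes "finite P"
    and "simple_collection P"
    and "\<forall>Q \<in> cell_components P. row_convex Q \<or> column_convex Q"
  shows "primeideal (inner_minor_ideal P :: 'k::field point_poly set)
           (poly_ring (vertices P))"
proof (rule primeideal_if_saturated[OF assms(1)], rule saturated_treelike[OF assms(1)])
  show "treelike P" by (rule simple_imp_treelike[OF assms(2)])
  fix C assume "C \<in> P"
  then have "connected_cells P `` {C} \<in> cell_components P"
    unfolding cell_components_def by (rule quotientI)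
  with assms(3) show "row_convex (connected_cells P `` {C}) \<or> column_convex (connected_cells P `` {C})"
    by blast
qed

end
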